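(* Let $G$ be a $2$-connected multigraph. Then the following are equivalent: (1) $G$ satisfies $(\spadesuit)_2$; (2) either $G$ is the $2$-cycle $C_2$, or $G$ can be obtained from cliques $K_4$ by repeated applications of Construction A with $\delta=2$ (i.e. $G$ belongs to the smallest class of multigraphs containing $K_4$ and closed under Construction A with $\delta=2$).
   Context: Multigraphs are finite, undirected, loop-free, and may have parallel edges. $C_2$ is the multigraph with two vertices and two parallel edges between them; $K_4$ is the complete simple graph on four vertices. For a multigraph $G=(V,E)$ and $S\subseteq V$, $E(S)$ denotes the set of edges with both endpoints in $S$, $G|_S$ the induced sub-multigraph on $S$, and $G/E(S)$ the result of contracting $E(S)$. A good flat of a $2$-connected multigraph $G=(V,E)$ is a subset $S\subsetneq V$ such that both $G|_S$ and $G/E(S)$ are $2$-connected. For an integer $\delta\ge 2$ and a $2$-connected multigraph $G=(V,E)$, the weight function $w\colon E\to\{1,\delta-1\}$ is given by $w(e)=1$ if $G\setminus e$ is $2$-connected and $w(e)=\delta-1$ if $G/e$ is $2$-connected; $w(F)=\sum_{e\in F}w(e)$. $G$ satisfies $(\spadesuit)_\delta$ if it possesses such a weight function and (1) $w(E)=\delta(|V|-1)$ and (2) $w(E(S))+1=\delta(|S|-1)$ for every good flat $S$. (For $\delta=2$ all weights equal $1$.) Construction A (parameter $\delta$): given $2$-connected multigraphs $G_1,G_2$ and edges $e_1$ of $G_1$ with $w(e_1)=1$ and $e_2$ of $G_2$ with $w(e_2)=\delta-1$, take the disjoint union, identify the endpoints of $e_1$ with those of $e_2$ (so that $e_1,e_2$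 become one glued edge), and delete the glued edge. *)

theory Defs
  imports Main
begin

record ('v, 'e) mgraph =
  verts :: "'v set"
  edges :: "'e set"
  ends :: "'e \<Rightarrow> 'v set"

definition multigraph :: "('v, 'e) mgraph \<Rightarrow> bool" where
  "multigraph G \<longleftrightarrow> finite (verts G) \<and> finite (edges G) \<and>
     (\<forall>e\<in>edges G. ends G e \<subseteq> verts G \<and> card (ends G e) = 2)"

text \<open>The well-formedness conjuncts are needed: without them, a structure with an
  edge leaving its vertex set could be isomorphic to a genuine multigraph.\<close>

definition mgraph_iso :: "('v, 'e) mgraph \<Rightarrow> ('w, 'f) mgraph \<Rightarrow> bool" where
  "mgraph_iso G H \<longleftrightarrow> multigraph G \<and> multigraph H \<and>
     (\<exists>f g. bij_betw f (verts G) (verts H) \<and> bij_betw g (edges G) (edges H) \<and>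
        (\<forall>e\<in>edges G. ends H (g e) = f ` ends G e))"

definition C2 :: "(nat, nat) mgraph" where
  "C2 = \<lparr>verts = {0, 1}, edges = {0, 1}, ends = (\<lambda>_. {0, 1})\<rparr>"

definition K4 :: "(nat, nat set) mgraph" where
  "K4 = \<lparr>verts = {0..<4}, edges = {s. s \<subseteq> {0..<4} \<and> card s = 2}, ends = (\<lambda>s. s)\<rparr>"

definition edges_within :: "('v, 'e) mgraph \<Rightarrow> 'v set \<Rightarrow> 'e set" where
  "edges_within G S = {e \<in> edges G. ends G e \<subseteq> S}"

definition induced :: "('v, 'e) mgraph \<Rightarrow> 'v set \<Rightarrow> ('v, 'e) mgraph" where
  "induced G S = \<lparr>verts = S, edges = edges_within G S, ends = ends G\<rparr>"

definition delete_edges :: "('v, 'e) mgraph \<Rightarrow> 'e set \<Rightarrow> ('v, 'e) mgraph" where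
  "delete_edges G F = \<lparr>verts = verts G, edges = edges G - F, ends = ends G\<rparr>"

definition joined_by :: "('v, 'e) mgraph \<Rightarrow> 'e set \<Rightarrow> ('v \<times> 'v) set" where
  "joined_by G F = {(u, v). u \<in> verts G \<and> v \<in> verts G \<and>
     (u, v) \<in> {(x, y). \<exists>e\<in>F. ends G e = {x, y}}\<^sup>*}"

definition connected_mgraph :: "('v, 'e) mgraph \<Rightarrow> bool" where
  "connected_mgraph G \<longleftrightarrow> verts G \<noteq> {} \<and> joined_by G (edges G) = verts G \<times> verts G"

text \<open>The vertices of \<open>G/F\<close> are the classes of vertices of \<open>G\<close> joined by paths in \<open>F\<close>.
  An edge outside \<open>F\<close> whose endpoints fall into one class becomes a loop (its \<open>ends\<close> is a
  singleton), so the result then violates \<open>multigraph\<close>.\<close>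

definition contract :: "('v, 'e) mgraph \<Rightarrow> 'e set \<Rightarrow> ('v set, 'e) mgraph" where
  "contract G F = \<lparr>verts = verts G // joined_by G F, edges = edges G - F,
     ends = (\<lambda>e. (\<lambda>v. joined_by G F `` {v}) ` ends G e)\<rparr>"

text \<open>A single vertex is not 2-connected, whereas two vertices joined by one or more
  parallel edges are; this agrees with connectedness of the cycle matroid.\<close>

definition two_connected :: "('v, 'e) mgraph \<Rightarrow> bool" where
  "two_connected G \<longleftrightarrow> multigraph G \<and> 2 \<le> card (verts G) \<and> connected_mgraph G \<and>
     (\<forall>v\<in>verts G. connected_mgraph (induced G (verts G - {v})))"

definition good_flat :: "('v, 'e) mgraph \<Rightarrow> 'v set \<Rightarrow> bool" where
  "good_flat G S \<longleftrightarrow> S \<subset> verts G \<and> two_connected (induced G S) \<and>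
     two_connected (contract G (edges_within G S))"

text \<open>For \<open>\<delta> > 2\<close> no such function exists if some edge can be both deleted and contracted
  without losing 2-connectedness.\<close>

definition weight_function :: "nat \<Rightarrow> ('v, 'e) mgraph \<Rightarrow> ('e \<Rightarrow> nat) \<Rightarrow> bool" where
  "weight_function \<delta> G w \<longleftrightarrow> (\<forall>e\<in>edges G. w e \<in> {1, \<delta> - 1} \<and>
     (two_connected (delete_edges G {e}) \<longrightarrow> w e = 1) \<and>
     (two_connected (contract G {e}) \<longrightarrow> w e = \<delta> - 1))"

definition spade :: "nat \<Rightarrow> ('v, 'e) mgraph \<Rightarrow> bool" where
  "spade \<delta> G \<longleftrightarrow> (\<exists>w. weight_function \<delta> G w \<and>
     sum w (edges G) = \<delta> * (card (verts G) - 1) \<and>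
     (\<forall>S. good_flat G S \<longrightarrow> sum w (edges_within G S) + 1 = \<delta> * (card S - 1)))"

definition disjoint_union ::
  "('v, 'e) mgraph \<Rightarrow> ('w, 'f) mgraph \<Rightarrow> ('v + 'w, 'e + 'f) mgraph" where
  "disjoint_union G H = \<lparr>verts = verts G <+> verts H, edges = edges G <+> edges H,
     ends = case_sum (\<lambda>e. Inl ` ends G e) (\<lambda>e. Inr ` ends H e)\<rparr>"

definition identify_verts :: "('v \<Rightarrow> 'w) \<Rightarrow> ('v, 'e) mgraph \<Rightarrow> ('w, 'e) mgraph" where
  "identify_verts q G = \<lparr>verts = q ` verts G, edges = edges G, ends = (\<lambda>e. q ` ends G e)\<rparr>"

text \<open>\<open>H\<close> arises by gluing \<open>e1\<close> (with endpoints \<open>a1\<close>, \<open>b1\<close>) to \<open>e2\<close> (with endpoints \<open>a2\<close>,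
  \<open>b2\<close>), identifying \<open>a1\<close> with \<open>a2\<close> and \<open>b1\<close> with \<open>b2\<close>. Both ways of matching the endpoints
  are covered, since \<open>a2\<close> and \<open>b2\<close> can be swapped. Deleting the glued edge amounts to deleting
  both of its preimages.\<close>

definition construction_A ::
  "nat \<Rightarrow> ('v, 'e) mgraph \<Rightarrow> ('w, 'f) mgraph \<Rightarrow> ('v + 'w, 'e + 'f) mgraph \<Rightarrow> bool" where
  "construction_A \<delta> G1 G2 H \<longleftrightarrow> two_connected G1 \<and> two_connected G2 \<and>
     (\<exists>w1 w2 e1 e2 a1 b1 a2 b2.
        weight_function \<delta> G1 w1 \<and> e1 \<in> edges G1 \<and> w1 e1 = 1 \<and> ends G1 e1 = {a1, b1} \<and>
        weight_function \<delta> G2 w2 \<and> e2 \<in> edges G2 \<and> w2 e2 = \<delta> - 1 \<and> ends G2 e2 = {a2, b2} \<and>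
        H = delete_edges
              (identify_verts (id(Inr a2 := Inl a1, Inr b2 := Inl b1)) (disjoint_union G1 G2))
              {Inl e1, Inr e2})"

text \<open>The smallest isomorphism-closed class containing \<open>K4\<close> and closed under Construction A.
  Every finite multigraph has an isomorphic copy with natural numbers as vertices and edges,
  so fixing these types loses nothing.\<close>

inductive K4_class :: "nat \<Rightarrow> (nat, nat) mgraph \<Rightarrow> bool" for \<delta> :: nat where
  K4: "mgraph_iso G K4 \<Longrightarrow> K4_class \<delta> G"
| construction_A: "K4_class \<delta> G1 \<Longrightarrow> K4_class \<delta> G2 \<Longrightarrow> construction_A \<delta> G1 G2 H \<Longrightarrow>
    mgraph_iso G H \<Longrightarrow> K4_class \<delta> G"

end

theory Submission
  imports Defs
begin

text \<open>
  For \<open>\<delta> = 2\<close> all weights are \<open>1\<close>. Put \<open>f(S) = 2|S| - 2 - |E(S)|\<close>; then \<open>(\<spadesuit>)\<close> says that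
  \<open>f(V) = 0\<close> and \<open>f(S) = 1\<close> for every good flat \<open>S\<close>, where the good flats are the sets \<open>S\<close> with
  \<open>G|S\<close> 2-connected and \<open>G - S\<close> connected. Modularity of \<open>f\<close> across small cuts extends this to
  \<open>f(S) \<ge> 1\<close> for all proper \<open>S\<close> with at least two vertices.

  If \<open>G - v\<close> is 2-connected for every \<open>v\<close>, then each \<open>V - {v}\<close> is a good flat, so \<open>G\<close> is cubic and
  counting edges gives \<open>|V| = 4\<close> and \<open>G = K4\<close>. Otherwise some pair \<open>{u, v}\<close> separates \<open>G\<close> into sides
  \<open>V1\<close> and \<open>V2\<close>. From \<open>f(V1) + f(V2) = f(V) + f({u, v}) \<le> 2\<close> it follows that
  \<open>f(V1) = f(V2) = 1\<close> and that \<open>u\<close>, \<open>v\<close> are not adjacent. Adding a virtual edge \<open>uv\<close> to each side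
  gives two smaller graphs of which \<open>G\<close> is the 2-sum, and the good flats of a 2-sum correspond to
  those of its parts, with equal values of \<open>f\<close>.
\<close>

section \<open>Connectedness by cuts\<close>

text \<open>These sets are the unions of components of \<open>G\<close> restricted to
  \<open>S\<close>. Describing connectedness by them avoids paths, and they are stable under
  complement in \<open>S\<close> and under restriction to subsets.\<close>

definition closed_in :: "('v, 'e) mgraph \<Rightarrow> 'v set \<Rightarrow> 'v set \<Rightarrow> bool" where
  "closed_in G S P \<longleftrightarrow> P \<subseteq> S \<and>
     (\<forall>e\<in>edges G. ends G e \<subseteq> S \<longrightarrow> ends G e \<inter> P \<noteq> {} \<longrightarrow> ends G e \<subseteq> P)"

text \<open>The vertex set is a parameter, so that many subsets of one graph can be compared without
  building induced graphs.\<close>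

definition conn :: "('v, 'e) mgraph \<Rightarrow> 'v set \<Rightarrow> bool" where
  "conn G S \<longleftrightarrow> S \<noteq> {} \<and> (\<forall>P. closed_in G S P \<longrightarrow> P = {} \<or> P = S)"

definition tconn :: "('v, 'e) mgraph \<Rightarrow> 'v set \<Rightarrow> bool" where
  "tconn G S \<longleftrightarrow> 2 \<le> card S \<and> conn G S \<and> (\<forall>v\<in>S. conn G (S - {v}))"

lemma closed_in_subset: "closed_in G S P \<Longrightarrow> P \<subseteq> S"
  by (simp add: closed_in_def)

lemma closed_inD:
  "closed_in G S P \<Longrightarrow> e \<in> edges G \<Longrightarrow> ends G e \<subseteq> S \<Longrightarrow> x \<in> ends G e \<Longrightarrow> x \<in> P \<Longrightarrow> ends G e \<subseteq> P"
  unfolding closed_in_def by blast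

lemma closed_inI:
  assumes "P \<subseteq> S"
    and "\<And>e x. e \<in> edges G \<Longrightarrow> ends G e \<subseteq> S \<Longrightarrow> x \<in> ends G e \<Longrightarrow> x \<in> P \<Longrightarrow> ends G e \<subseteq> P"
  shows "closed_in G S P"
  using assms unfolding closed_in_def by blast

lemma closed_in_Diff: "closed_in G S P \<Longrightarrow> closed_in G S (S - P)"
  unfolding closed_in_def by blast

lemma closed_in_Int: "closed_in G S P \<Longrightarrow> W \<subseteq> S \<Longrightarrow> closed_in G W (P \<inter> W)"
  unfolding closed_in_def by blast

lemma connD: "conn G S \<Longrightarrow> closed_in G S P \<Longrightarrow> P \<noteq> {} \<Longrightarrow> P = S"
  by (auto simp: conn_def)

lemma conn_nonempty: "conn G S \<Longrightarrow> S \<noteq> {}"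
  by (simp add: conn_def)

lemma connI:
  assumes "S \<noteq> {}" "\<And>P. closed_in G S P \<Longrightarrow> P \<noteq> {} \<Longrightarrow> P = S"
  shows "conn G S"
  using assms by (auto simp: conn_def)

lemma conn_singleton: "conn G {x}"
  by (rule connI) (auto dest: closed_in_subset)

text \<open>The hypothesis on \<open>Q\<close> is applied twice: a nonempty closed \<open>P\<close>
  meets \<open>W\<close>, hence contains \<open>W\<close>; its complement is closed as well and
  misses \<open>W\<close>, hence is empty.\<close>

lemma conn_extend:
  assumes W: "conn G W" "W \<subseteq> S"
    and *: "\<And>Q. closed_in G S Q \<Longrightarrow> Q \<inter> W = {} \<Longrightarrow> Q = {}"
  shows "conn G S"
proof (rule connI)
  show "S \<noteq> {}" using W conn_nonempty by blast
  fix P assume P: "closed_in G S P" "P \<noteq> {}"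
  then have "P \<inter> W \<noteq> {}" using * by blast
  then have "P \<inter> W = W" using closed_in_Int[OF P(1) W(2)] connD[OF W(1)] by blast
  then have "(S - P) \<inter> W = {}" by blast
  then have "S - P = {}" using *[OF closed_in_Diff[OF P(1)]] by blast
  then show "P = S" using closed_in_subset[OF P(1)] by blast
qed

lemma conn_Un:
  assumes "conn G S" "conn G T" "S \<inter> T \<noteq> {}"
  shows "conn G (S \<union> T)"
proof (rule conn_extend[OF assms(1)])
  fix Q assume Q: "closed_in G (S \<union> T) Q" "Q \<inter> S = {}"
  have "Q \<inter> T = {} \<or> Q \<inter> T = T"
    using closed_in_Int[OF Q(1), of T] connD[OF assms(2)] by blast
  then show "Q = {}" using Q assms(3) closed_in_subset[OF Q(1)] by blast
qed auto

lemma tconnD: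
  assumes "tconn G S"
  shows "2 \<le> card S" "finite S" "conn G S" "\<And>v. v \<in> S \<Longrightarrow> conn G (S - {v})"
    "\<And>v. conn G (S - {v})"
proof -
  show "2 \<le> card S" "conn G S" and 1: "\<And>v. v \<in> S \<Longrightarrow> conn G (S - {v})"
    using assms by (auto simp: tconn_def)
  \<comment> \<open>An infinite set has \<open>card\<close> equal to 0, against the bound 2.\<close>
  then show "finite S" using card.infinite by fastforce
  show "conn G (S - {v})" for v
    using 1 \<open>conn G S\<close> by (cases "v \<in> S") auto
qed

lemma multigraphD:
  assumes "multigraph G"
  shows "finite (verts G)" "finite (edges G)"
    "\<And>e. e \<in> edges G \<Longrightarrow> ends G e \<subseteq> verts G" "\<And>e. e \<in> edges G \<Longrightarrow> card (ends G e) = 2"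
  using assms by (auto simp: multigraph_def)

lemma ends_obtain:
  assumes "multigraph G" "e \<in> edges G" "x \<in> ends G e"
  obtains y where "ends G e = {x, y}" "x \<noteq> y"
  using multigraphD(4)[OF assms(1,2)] assms(3) by (auto simp: card_2_iff doubleton_eq_iff)

text \<open>Membership in a closed set propagates along paths; conversely, the set of vertices
  reachable from \<open>x\<close> is closed, so it is everything.\<close>

lemma connected_mgraph_iff_conn:
  assumes G: "multigraph G"
  shows "connected_mgraph G \<longleftrightarrow> conn G (verts G)"
proof
  let ?r = "{(x, y). \<exists>e\<in>edges G. ends G e = {x, y}}"
  assume c: "connected_mgraph G"
  show "conn G (verts G)"
  proof (rule connI)
    show "verts G \<noteq> {}" using c by (simp add: connected_mgraph_def)
    fix P assume P: "closed_in G (verts G) P" "P \<noteq> {}"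
    then obtain x where x: "x \<in> P" by blast
    have "y \<in> P" if "y \<in> verts G" for y
    proof -
      have "(x, y) \<in> verts G \<times> verts G" using x P that closed_in_subset by blast
      then have "(x, y) \<in> joined_by G (edges G)" using c by (simp add: connected_mgraph_def)
      then have "(x, y) \<in> ?r\<^sup>*" by (simp add: joined_by_def)
      then show "y \<in> P"
      proof induction
        case base
        show ?case by (fact x)
      next
        case (step y z)
        then obtain e where "e \<in> edges G" "ends G e = {y, z}" by auto
        then show ?case using closed_inD[OF P(1), of e y] multigraphD(3)[OF G] step by auto
      qed
    qed
    then show "P = verts G" using closed_in_subset[OF P(1)] by blast
  qed
next
  let ?r = "{(x, y). \<exists>e\<in>edges G. ends G e = {x, y}}"
  assume c: "conn G (verts G)"
  have "(x, y) \<in> ?r\<^sup>*" if xy: "x \<in> verts G" "y \<in> verts G" for x y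
  proof -
    let ?P = "{y \<in> verts G. (x, y) \<in> ?r\<^sup>*}"
    have "closed_in G (verts G) ?P"
    proof (rule closed_inI)
      fix e a assume e: "e \<in> edges G" "ends G e \<subseteq> verts G" "a \<in> ends G e" "a \<in> ?P"
      obtain b where b: "ends G e = {a, b}" using ends_obtain[OF G e(1,3)] by blast
      then have "(a, b) \<in> ?r" using e(1) by blast
      then have "(x, b) \<in> ?r\<^sup>*" using e(4) by (blast intro: rtrancl_into_rtrancl)
      then show "ends G e \<subseteq> ?P" using b e by auto
    qed auto
    moreover have "x \<in> ?P" using xy by simp
    ultimately have "?P = verts G" using connD[OF c] by blast
    then show ?thesis using xy by blast
  qed
  then show "connected_mgraph G"
    using conn_nonempty[OF c] by (auto simp: connected_mgraph_def joined_by_def)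
qed

lemma induced_simps [simp]:
  "verts (induced G S) = S" "edges (induced G S) = edges_within G S" "ends (induced G S) = ends G"
  by (simp_all add: induced_def)

lemma multigraph_induced: "multigraph G \<Longrightarrow> S \<subseteq> verts G \<Longrightarrow> multigraph (induced G S)"
  by (auto simp: multigraph_def edges_within_def intro: finite_subset)

lemma conn_induced:
  assumes "T \<subseteq> S"
  shows "conn (induced G S) T \<longleftrightarrow> conn G T"
proof -
  have "closed_in (induced G S) T P \<longleftrightarrow> closed_in G T P" for P
    using assms unfolding closed_in_def edges_within_def induced_simps by blast
  then show ?thesis by (simp add: conn_def)
qed

lemma connected_mgraph_induced:
  assumes "multigraph G" "S \<subseteq> verts G"
  shows "connected_mgraph (induced G S) \<longleftrightarrow> conn G S"
  using connected_mgraph_iff_conn[OF multigraph_induced[OF assms]] conn_induced[of S S G] by simp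

lemma two_connected_iff_tconn: "two_connected G \<longleftrightarrow> multigraph G \<and> tconn G (verts G)"
  by (auto simp: two_connected_def tconn_def connected_mgraph_iff_conn connected_mgraph_induced)

lemma two_connected_induced:
  assumes "multigraph G" "S \<subseteq> verts G"
  shows "two_connected (induced G S) \<longleftrightarrow> tconn G S"
  using conn_induced[of _ S G] multigraph_induced[OF assms]
  by (auto simp: two_connected_iff_tconn tconn_def)

section \<open>Good flats\<close>

text \<open>Contraction turns \<open>S\<close> into one vertex. Deleting that vertex leaves a copy
  of \<open>G - S\<close>, while deleting any other vertex \<open>z\<close> leaves an image of the
  connected graph \<open>G - z\<close>. Hence only the connectedness of \<open>G - S\<close> is at
  stake.\<close>

lemma two_connected_contract:
  fixes G :: "('v, 'e) mgraph"
  assumes G: "two_connected G" and S: "tconn G S" "S \<subset> verts G"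
  shows "two_connected (contract G (edges_within G S)) \<longleftrightarrow> conn G (verts G - S)"
proof -
  let ?V = "verts G" and ?F = "edges_within G S" and ?H = "contract G (edges_within G S)"
  let ?r = "{(x, y). \<exists>e\<in>?F. ends G e = {x, y}}"
  \<comment> \<open>The quotient map in explicit form: the classes are \<open>S\<close> and the
    singletons outside it.\<close>
  define c where "c x = (if x \<in> S then S else {x})" for x
  have mg: "multigraph G" and tc: "tconn G ?V" using G by (simp_all add: two_connected_iff_tconn)
  have SV: "S \<subseteq> ?V" using S by blast
  have reach: "(x, y) \<in> ?r\<^sup>*" if "x \<in> S" "y \<in> S" for x y
  proof -
    have "connected_mgraph (induced G S)"
      using connected_mgraph_induced[OF mg SV] tconnD(3)[OF S(1)] by simp
    then have "joined_by (induced G S) ?F = S \<times> S" by (simp add: connected_mgraph_def)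
    then have "(x, y) \<in> joined_by (induced G S) ?F" using that by simp
    then show ?thesis by (simp add: joined_by_def)
  qed
  have r_eq: "x = y \<or> x \<in> S \<and> y \<in> S" if "(x, y) \<in> ?r\<^sup>*" for x y
    using that by induction (auto simp: edges_within_def)
  have cl: "joined_by G ?F `` {x} = c x" if "x \<in> ?V" for x
    using that reach r_eq SV by (auto simp: joined_by_def c_def)
  have vH: "verts ?H = c ` ?V" using cl by (auto simp: contract_def quotient_def)
  have eH: "edges ?H = edges G - ?F" by (simp add: contract_def)
  have endsH: "ends ?H e = c ` ends G e" if "e \<in> edges G" for e
  proof -
    have "ends ?H e = (\<lambda>v. joined_by G ?F `` {v}) ` ends G e" by (simp add: contract_def)
    then show ?thesis using cl multigraphD(3)[OF mg that] by (auto intro!: image_cong)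
  qed
  have c_eq: "c x = c y \<longleftrightarrow> x = y \<or> x \<in> S \<and> y \<in> S" for x y by (auto simp: c_def)
  have mgH: "multigraph ?H"
    unfolding multigraph_def
  proof (intro conjI ballI)
    show "finite (verts ?H)" "finite (edges ?H)" using vH eH multigraphD[OF mg] by auto
    fix e assume e: "e \<in> edges ?H"
    then have eG: "e \<in> edges G" "e \<notin> ?F" using eH by auto
    show "ends ?H e \<subseteq> verts ?H" using endsH[OF eG(1)] multigraphD(3)[OF mg eG(1)] vH by auto
    obtain x y where xy: "ends G e = {x, y}" "x \<noteq> y"
      using multigraphD(4)[OF mg eG(1)] by (auto simp: card_2_iff)
    then have "c x \<noteq> c y" using eG by (auto simp: c_eq edges_within_def)
    then show "card (ends ?H e) = 2" using endsH[OF eG(1)] xy by simp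
  qed
  \<comment> \<open>Closed sets of the contraction pull back along \<open>c\<close>; an edge inside
    \<open>S\<close> causes no trouble because both of its ends have the same class.\<close>
  have up: "conn ?H (c ` T)" if T: "conn G T" "T \<subseteq> ?V" and sat: "S \<subseteq> T \<or> S \<inter> T = {}" for T
  proof (rule connI)
    show "c ` T \<noteq> {}" using conn_nonempty[OF T(1)] by simp
    fix P' assume P': "closed_in ?H (c ` T) P'" "P' \<noteq> {}"
    let ?P = "{x \<in> T. c x \<in> P'}"
    have "closed_in G T ?P"
    proof (rule closed_inI)
      fix e x assume e: "e \<in> edges G" "ends G e \<subseteq> T" "x \<in> ends G e" "x \<in> ?P"
      show "ends G e \<subseteq> ?P"
      proof (cases "e \<in> ?F")
        case True
        then have "c y \<in> P'" if "y \<in> ends G e" for y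
          using that e(3,4) c_eq[of x y] by (auto simp: edges_within_def)
        then show ?thesis using e(2) by auto
      next
        case False
        then have "c ` ends G e \<subseteq> P'"
          using closed_inD[OF P'(1), of e "c x"] eH endsH[OF e(1)] e image_mono[OF e(2), of c] by auto
        then show ?thesis using e(2) by auto
      qed
    qed auto
    moreover have "?P \<noteq> {}" using P' closed_in_subset by fastforce
    ultimately have "?P = T" using connD[OF T(1)] by blast
    then show "P' = c ` T" using closed_in_subset[OF P'(1)] by blast
  qed
  \<comment> \<open>A class \<open>{y}\<close> with \<open>y\<close> outside \<open>S\<close> never
    equals \<open>S\<close>, so \<open>c\<close> does not merge the two regions.\<close>
  have inj: "x \<in> ?V - S \<longleftrightarrow> c x \<in> c ` (?V - S)" for x by (auto simp: c_def)
  have down: "conn G (?V - S)" if T: "conn ?H (c ` (?V - S))"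
  proof (rule connI)
    show "?V - S \<noteq> {}" using S by blast
    fix P assume P: "closed_in G (?V - S) P" "P \<noteq> {}"
    have PS: "P \<subseteq> ?V - S" using P(1) closed_in_subset by blast
    have "closed_in ?H (c ` (?V - S)) (c ` P)"
    proof (rule closed_inI)
      show "c ` P \<subseteq> c ` (?V - S)" using PS by blast
      fix e x assume e: "e \<in> edges ?H" "ends ?H e \<subseteq> c ` (?V - S)" "x \<in> ends ?H e" "x \<in> c ` P"
      then have eG: "e \<in> edges G" using eH by simp
      have sub: "ends G e \<subseteq> ?V - S" using e(2) inj endsH[OF eG] by blast
      obtain y z where "y \<in> ends G e" "z \<in> P" "c y = c z" using e endsH[OF eG] by auto
      then have "y \<in> P" using sub PS c_eq by auto
      then have "ends G e \<subseteq> P" using closed_inD[OF P(1) eG sub] \<open>y \<in> ends G e\<close> by blast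
      then show "ends ?H e \<subseteq> c ` P" using endsH[OF eG] by blast
    qed
    then have eq: "c ` P = c ` (?V - S)" using connD[OF T] P(2) by blast
    show "P = ?V - S"
    proof (rule equalityI[OF PS], rule subsetI)
      fix x assume x: "x \<in> ?V - S"
      then obtain z where "z \<in> P" "c x = c z" using eq by blast
      then show "x \<in> P" using x c_eq by auto
    qed
  qed
  obtain s where s: "s \<in> S" using tconnD(3)[OF S(1)] conn_nonempty by blast
  have c_minus: "c ` ?V - {c z} = c ` {x \<in> ?V. c x \<noteq> c z}" for z by auto
  have "{x \<in> ?V. c x \<noteq> c s} = ?V - S" using s c_eq by auto
  then have cs: "c ` ?V - {c s} = c ` (?V - S)" using c_minus[of s] by simp
  show ?thesis
  proof
    assume "two_connected ?H"
    then have "conn ?H (verts ?H - {c s})" by (auto simp: two_connected_iff_tconn tconnD(5))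
    then show "conn G (?V - S)" using down cs vH by simp
  next
    assume c: "conn G (?V - S)"
    obtain t where t: "t \<in> ?V" "t \<notin> S" using S by blast
    have "card {c s, c t} \<le> card (c ` ?V)"
      using s t SV multigraphD(1)[OF mg] by (intro card_mono) auto
    then have "2 \<le> card (c ` ?V)" using s t by (auto simp: c_eq card_insert_if split: if_splits)
    moreover have "conn ?H (c ` ?V)" using up[of ?V] tconnD(3)[OF tc] SV by auto
    moreover have "conn ?H (c ` ?V - {c z})" if z: "z \<in> ?V" for z
    proof (cases "z \<in> S")
      case True
      then have "c z = c s" using s c_eq by blast
      then show ?thesis using up[of "?V - S"] c cs by auto
    next
      case False
      then have "{x \<in> ?V. c x \<noteq> c z} = ?V - {z}" using c_eq by auto
      then have "c ` ?V - {c z} = c ` (?V - {z})" using c_minus[of z] by simp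
      then show ?thesis using up[of "?V - {z}"] tconnD(4)[OF tc z] False SV by auto
    qed
    ultimately have "tconn ?H (verts ?H)" using vH by (auto simp: tconn_def)
    then show "two_connected ?H" using mgH by (simp add: two_connected_iff_tconn)
  qed
qed

text \<open>This is f(V) = 0 together with f(S) = 1 for the good flats, which are described by cuts.
  Additions replace subtractions, since subtraction on \<open>nat\<close> truncates.\<close>

definition tight :: "('v, 'e) mgraph \<Rightarrow> bool" where
  "tight G \<longleftrightarrow> card (edges G) + 2 = 2 * card (verts G) \<and>
     (\<forall>S. S \<subset> verts G \<and> tconn G S \<and> conn G (verts G - S) \<longrightarrow>
        card (edges_within G S) + 3 = 2 * card S)"

text \<open>For \<open>\<delta> = 2\<close> both admissible weights are 1, so every weight sum is a
  cardinality. The translation of \<open>card S - 1\<close> is safe because all sets involved have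
  at least two vertices.\<close>

lemma spade_2_iff_tight:
  assumes G: "two_connected G"
  shows "spade 2 G \<longleftrightarrow> tight G"
proof -
  have mg: "multigraph G" and "2 \<le> card (verts G)"
    using G by (auto simp: two_connected_def)
  have gf: "good_flat G S \<longleftrightarrow> S \<subset> verts G \<and> tconn G S \<and> conn G (verts G - S)" for S
    using two_connected_contract[OF G, of S] two_connected_induced[OF mg, of S]
    by (auto simp: good_flat_def)
  have w: "weight_function 2 G w \<longleftrightarrow> (\<forall>e\<in>edges G. w e = 1)" for w
    by (auto simp: weight_function_def)
  have sumw: "sum w F = card F" if "\<forall>e\<in>edges G. w e = 1" "F \<subseteq> edges G" for w :: "_ \<Rightarrow> nat" and F
  proof -
    have "sum w F = sum (\<lambda>_. 1) F" using that by (intro sum.cong) auto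
    then show ?thesis by simp
  qed
  have "spade 2 G \<longleftrightarrow> card (edges G) = 2 * (card (verts G) - 1) \<and>
     (\<forall>S. good_flat G S \<longrightarrow> card (edges_within G S) + 1 = 2 * (card S - 1))"
  proof
    assume "spade 2 G"
    then obtain w where "weight_function 2 G w"
      "sum w (edges G) = 2 * (card (verts G) - 1)"
      "\<forall>S. good_flat G S \<longrightarrow> sum w (edges_within G S) + 1 = 2 * (card S - 1)"
      by (auto simp: spade_def)
    then show "card (edges G) = 2 * (card (verts G) - 1) \<and>
     (\<forall>S. good_flat G S \<longrightarrow> card (edges_within G S) + 1 = 2 * (card S - 1))"
      using sumw[of w] w[of w] by (simp add: edges_within_def)
  next
    assume *: "card (edges G) = 2 * (card (verts G) - 1) \<and>
     (\<forall>S. good_flat G S \<longrightarrow> card (edges_within G S) + 1 = 2 * (card S - 1))"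
    show "spade 2 G"
      unfolding spade_def by (rule exI[of _ "\<lambda>_. 1"]) (use * w in simp)
  qed
  also have "\<dots> \<longleftrightarrow> tight G"
  proof -
    have "card (edges G) = 2 * (card (verts G) - 1) \<longleftrightarrow> card (edges G) + 2 = 2 * card (verts G)"
      using \<open>2 \<le> card (verts G)\<close> by arith
    moreover have "card (edges_within G S) + 1 = 2 * (card S - 1) \<longleftrightarrow>
        card (edges_within G S) + 3 = 2 * card S" if "tconn G S" for S
      using tconnD(1)[OF that] by arith
    ultimately show ?thesis unfolding tight_def gf by blast
  qed
  finally show ?thesis .
qed

section \<open>Counting edges in proper vertex subsets\<close>

lemma finite_edges_within: "multigraph G \<Longrightarrow> finite (edges_within G S)"
  by (simp add: edges_within_def multigraph_def)

lemma card_edges_within_le: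
  assumes "multigraph G" "\<And>e. e \<in> edges G \<Longrightarrow> ends G e \<subseteq> S \<Longrightarrow> ends G e \<subseteq> A \<or> ends G e \<subseteq> B"
  shows "card (edges_within G S) \<le> card (edges_within G A) + card (edges_within G B)"
proof -
  have "card (edges_within G S) \<le> card (edges_within G A \<union> edges_within G B)"
    using assms finite_edges_within[OF assms(1)]
    by (intro card_mono) (auto simp: edges_within_def)
  also have "\<dots> \<le> card (edges_within G A) + card (edges_within G B)" by (rule card_Un_le)
  finally show ?thesis .
qed

text \<open>No edge leaves \<open>P\<close> except towards \<open>S\<close>. So a closed part of
  \<open>(S \<union> P) - Z\<close> that misses \<open>S\<close> is already closed in
  \<open>V - Z\<close>, which is connected, and therefore is empty. The lemma is used with
  \<open>Z\<close> empty and with \<open>Z\<close> a single vertex.\<close>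

lemma conn_Un_closed:
  assumes mg: "multigraph G" and c: "conn G (verts G - Z)" "conn G (S - Z)" and S: "S \<subseteq> verts G"
    and P: "closed_in G (verts G - S) P"
  shows "conn G ((S \<union> P) - Z)"
proof (rule conn_extend[OF c(2)])
  show "S - Z \<subseteq> S \<union> P - Z" by blast
  fix Q assume Q: "closed_in G (S \<union> P - Z) Q" "Q \<inter> (S - Z) = {}"
  have QP: "Q \<subseteq> P - Z" using Q closed_in_subset by fastforce
  have PV: "P \<subseteq> verts G - S" using P closed_in_subset by blast
  have "closed_in G (verts G - Z) Q"
  proof (rule closed_inI)
    show "Q \<subseteq> verts G - Z" using QP PV by blast
    fix e x assume e: "e \<in> edges G" "ends G e \<subseteq> verts G - Z" "x \<in> ends G e" "x \<in> Q"
    obtain y where y: "ends G e = {x, y}" using ends_obtain[OF mg e(1,3)] by blast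
    have "y \<in> S \<union> P"
    proof (rule ccontr)
      assume "y \<notin> S \<union> P"
      then have "ends G e \<subseteq> verts G - S" using y e QP PV by auto
      then show False using closed_inD[OF P e(1) _ e(3)] e(4) QP y \<open>y \<notin> S \<union> P\<close> by auto
    qed
    then have "ends G e \<subseteq> S \<union> P - Z" using y e QP by auto
    then show "ends G e \<subseteq> Q" using closed_inD[OF Q(1) e(1) _ e(3,4)] by blast
  qed
  then have "Q = {} \<or> Q = verts G - Z" using c(1) by (auto simp: conn_def)
  then show "Q = {}" using Q(2) S conn_nonempty[OF c(2)] by blast
qed

lemma tconn_Un_closed:
  assumes mg: "multigraph G" and V: "tconn G (verts G)" and S: "tconn G S" "S \<subseteq> verts G"
    and P: "closed_in G (verts G - S) P"
  shows "tconn G (S \<union> P)"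
proof -
  have fin: "finite (S \<union> P)"
    using closed_in_subset[OF P] S(2) multigraphD(1)[OF mg] by (auto intro: finite_subset)
  have "card S \<le> card (S \<union> P)" using fin by (intro card_mono) auto
  then have "2 \<le> card (S \<union> P)" using tconnD(1)[OF S(1)] by linarith
  moreover have "conn G (S \<union> P)"
    using conn_Un_closed[OF mg _ _ S(2) P, of "{}"] tconnD(3)[OF V] tconnD(3)[OF S(1)] by simp
  moreover have "conn G (S \<union> P - {v})" for v
    by (rule conn_Un_closed[OF mg _ _ S(2) P]) (use tconnD(5)[OF V] tconnD(5)[OF S(1)] in auto)
  ultimately show ?thesis by (simp add: tconn_def)
qed

text \<open>Induction on the size of \<open>V - S\<close>. If \<open>V - S\<close> falls apart into
  \<open>P\<close> and \<open>Q\<close>, the larger sets \<open>S \<union> P\<close> and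
  \<open>S \<union> Q\<close> are again 2-connected, and modularity gives f(S) = f(S \<union> P) +
  f(S \<union> Q) - f(V), which is at least 1 + 1 - 0.\<close>

lemma tight_tconn_bound:
  assumes mg: "multigraph G" and V: "tconn G (verts G)" and t: "tight G"
    and S: "tconn G S" "S \<subset> verts G"
  shows "card (edges_within G S) + 3 \<le> 2 * card S"
  using S
proof (induction "card (verts G - S)" arbitrary: S rule: less_induct)
  case less
  let ?V = "verts G"
  have fV: "finite ?V" using mg by (rule multigraphD)
  show ?case
  proof (cases "conn G (?V - S)")
    case True
    then show ?thesis using t less.prems by (auto simp: tight_def)
  next
    case False
    then obtain P where P: "closed_in G (?V - S) P" "P \<noteq> {}" "P \<noteq> ?V - S"
      using less.prems unfolding conn_def by blast
    have PV: "P \<subseteq> ?V - S" using P closed_in_subset by blast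
    define Q where "Q = ?V - S - P"
    have Q: "closed_in G (?V - S) Q" "Q \<noteq> {}" "Q \<subseteq> ?V - S" "P \<inter> Q = {}"
      using closed_in_Diff[OF P(1)] P PV unfolding Q_def by auto
    have SV: "S \<subseteq> ?V" using less.prems by blast
    have IH: "card (edges_within G (S \<union> R)) + 3 \<le> 2 * card (S \<union> R)"
      if R: "closed_in G (?V - S) R" "R \<noteq> {}" "R \<noteq> ?V - S" for R
    proof (rule less.hyps)
      have RV: "R \<subseteq> ?V - S" using R closed_in_subset by blast
      show "card (?V - (S \<union> R)) < card (?V - S)"
        using RV R fV by (intro psubset_card_mono) auto
      show "tconn G (S \<union> R)" using tconn_Un_closed[OF mg V less.prems(1) SV R(1)] .
      show "S \<union> R \<subset> ?V" using RV R SV by blast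
    qed
    have "edges_within G (S \<union> P) \<union> edges_within G (S \<union> Q) = edges G"
    proof (rule equalityI)
      show "edges G \<subseteq> edges_within G (S \<union> P) \<union> edges_within G (S \<union> Q)"
      proof
        fix e assume e: "e \<in> edges G"
        have eV: "ends G e \<subseteq> ?V" using multigraphD(3)[OF mg e] .
        obtain x y where xy: "ends G e = {x, y}"
          using multigraphD(4)[OF mg e] by (auto simp: card_2_iff)
        have "ends G e \<subseteq> S \<union> P \<or> ends G e \<subseteq> S \<union> Q"
        proof (cases "ends G e \<subseteq> ?V - S")
          case True
          then show ?thesis
            using closed_inD[OF P(1) e True, of x] closed_inD[OF Q(1) e True, of x] xy
            unfolding Q_def by auto
        next
          case False
          then show ?thesis using xy eV unfolding Q_def by auto
        qed
        then show "e \<in> edges_within G (S \<union> P) \<union> edges_within G (S \<union> Q)"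
          using e by (auto simp: edges_within_def)
      qed
    qed (auto simp: edges_within_def)
    moreover have "edges_within G (S \<union> P) \<inter> edges_within G (S \<union> Q) = edges_within G S"
      using Q(4) by (auto simp: edges_within_def)
    ultimately have "card (edges_within G (S \<union> P)) + card (edges_within G (S \<union> Q))
        = card (edges G) + card (edges_within G S)"
      using card_Un_Int[OF finite_edges_within finite_edges_within, OF mg mg, of "S \<union> P" "S \<union> Q"]
      by simp
    moreover have "card (S \<union> P) + card (S \<union> Q) = card ?V + card S"
    proof -
      have fin: "finite S" "finite P" "finite Q" using fV SV PV Q(3) by (meson finite_subset finite_Diff)+
      have "(S \<union> P) \<union> (S \<union> Q) = ?V" "(S \<union> P) \<inter> (S \<union> Q) = S"
        using SV PV Q unfolding Q_def by auto
      then show ?thesis using card_Un_Int[of "S \<union> P" "S \<union> Q"] fin by simp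
    qed
    moreover have "card (edges_within G (S \<union> P)) + 3 \<le> 2 * card (S \<union> P)"
      using IH P by blast
    moreover have "card (edges_within G (S \<union> Q)) + 3 \<le> 2 * card (S \<union> Q)"
      using IH[OF Q(1,2)] P PV unfolding Q_def by blast
    moreover have "card (edges G) + 2 = 2 * card ?V" using t by (simp add: tight_def)
    ultimately show ?thesis by linarith
  qed
qed

text \<open>Induction on the size of \<open>S\<close>. If \<open>S\<close> is not 2-connected, it
  splits along the empty set or along a cut vertex, and in both cases the values of f on the two
  pieces force f(S) to be at least 2.\<close>

lemma tight_bound:
  assumes mg: "multigraph G" and V: "tconn G (verts G)" and t: "tight G"
    and S: "2 \<le> card S" "S \<subset> verts G"
  shows "card (edges_within G S) + 3 \<le> 2 * card S"
  using S
proof (induction "card S" arbitrary: S rule: less_induct)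
  case less
  have fS: "finite S" using less.prems multigraphD(1)[OF mg] finite_subset by blast
  show ?case
  proof (cases "tconn G S")
    case True
    then show ?thesis using tight_tconn_bound[OF mg V t] less.prems by blast
  next
    case False
    \<comment> \<open>A single vertex has f = 0, so on all nonempty proper subsets only f \<ge> 0 is
      available, with f \<ge> 1 from two vertices on.\<close>
    have IH: "card (edges_within G T) + 2 \<le> 2 * card T \<and>
        (2 \<le> card T \<longrightarrow> card (edges_within G T) + 3 \<le> 2 * card T)" if T: "T \<subset> S" "T \<noteq> {}" for T
    proof (cases "2 \<le> card T")
      case True
      moreover have "T \<subset> verts G" using T less.prems by blast
      ultimately show ?thesis
        using less.hyps[of T] psubset_card_mono[OF fS T(1)] by linarith
    next
      case False
      have "card T \<noteq> 0" using T fS by (auto dest: finite_subset)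
      then have "card T = 1" using False by linarith
      have "edges_within G T = {}"
      proof (rule ccontr)
        assume "edges_within G T \<noteq> {}"
        then obtain e where "e \<in> edges G" "ends G e \<subseteq> T" by (auto simp: edges_within_def)
        moreover have "finite T" using T fS by (auto dest: finite_subset)
        ultimately show False
          using card_mono[of T "ends G e"] multigraphD(4)[OF mg] \<open>card T = 1\<close> by fastforce
      qed
      then show ?thesis using \<open>card T = 1\<close> by simp
    qed
    show ?thesis
    proof (cases "conn G S")
      case nc: False
      then obtain P where P: "closed_in G S P" "P \<noteq> {}" "P \<noteq> S"
        using less.prems(1) unfolding conn_def by fastforce
      have PS: "P \<subseteq> S" using P closed_in_subset by blast
      \<comment> \<open>Splitting along the empty set gains 2: f(S) \<ge> f(P) + f(S - P) + 2, so f
        \<ge> 0 on the pieces suffices.\<close>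
      have "card (edges_within G S) \<le> card (edges_within G P) + card (edges_within G (S - P))"
        by (rule card_edges_within_le[OF mg]) (use P(1) in \<open>auto simp: closed_in_def\<close>)
      moreover have "card S = card P + card (S - P)"
        using PS fS by (metis card_Diff_subset card_mono finite_subset le_add_diff_inverse)
      moreover have "P \<subset> S" "S - P \<subset> S" "S - P \<noteq> {}" using P PS by auto
      ultimately show ?thesis using IH[of P] IH[of "S - P"] P(2) by linarith
    next
      case True
      then obtain x where x: "x \<in> S" "\<not> conn G (S - {x})"
        using False less.prems by (auto simp: tconn_def)
      have "card (S - {x}) \<noteq> 0" using less.prems(1) x fS by simp
      then have "S - {x} \<noteq> {}" by force
      then obtain P where P: "closed_in G (S - {x}) P" "P \<noteq> {}" "P \<noteq> S - {x}"
        using x unfolding conn_def by blast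
      have PS: "P \<subseteq> S - {x}" using P closed_in_subset by blast
      \<comment> \<open>The pieces share exactly the cut vertex \<open>x\<close>, so f(S) \<ge>
        f(\<open>insert x P\<close>) + f(S - P). Here nothing is gained, and both pieces must be
        shown to have two vertices.\<close>
      have "card (edges_within G S) \<le> card (edges_within G (insert x P)) + card (edges_within G (S - P))"
      proof (rule card_edges_within_le[OF mg])
        fix e assume e: "e \<in> edges G" "ends G e \<subseteq> S"
        show "ends G e \<subseteq> insert x P \<or> ends G e \<subseteq> S - P"
        proof (cases "x \<in> ends G e")
          case True
          then obtain y where "ends G e = {x, y}" using ends_obtain[OF mg e(1)] by blast
          then show ?thesis using e x PS by auto
        next
          case False
          then show ?thesis using closed_inD[OF P(1) e(1)] e(2) by blast
        qed
      qed
      moreover have fP: "finite P" using PS fS by (meson finite_Diff finite_subset)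
      moreover have "card (insert x P) = card P + 1" using card_insert_disjoint[OF fP, of x] PS by auto
      moreover have "card S = card P + card (S - P)"
      proof -
        have "P \<union> (S - P) = S" using PS by blast
        then show ?thesis using card_Un_disjoint[OF fP, of "S - P"] fS by auto
      qed
      moreover have "card P \<noteq> 0" using P(2) fP by simp
      then have "2 \<le> card (insert x P)" using \<open>card (insert x P) = card P + 1\<close> by linarith
      moreover have "insert x P \<subset> S" "S - P \<subset> S" "S - P \<noteq> {}" using P PS x by auto
      moreover have "2 \<le> card (S - P)"
      proof -
        obtain y where y: "y \<in> S - {x}" "y \<notin> P" using P PS by blast
        then have "card {x, y} \<le> card (S - P)" using x PS fS by (intro card_mono) auto
        then show ?thesis using y by auto
      qed
      ultimately show ?thesis
        using IH[of "insert x P"] IH[of "S - P"] by (simp del: card_insert_disjoint)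
    qed
  qed
qed

section \<open>Separations of order two\<close>

text \<open>\<open>None\<close> is the virtual edge. The option type keeps it distinct from every
  edge of \<open>F\<close>, including edges that already join \<open>u\<close> and
  \<open>v\<close>.\<close>

definition torso :: "('v, 'e) mgraph \<Rightarrow> 'v set \<Rightarrow> 'e set \<Rightarrow> 'v \<Rightarrow> 'v \<Rightarrow> ('v, 'e option) mgraph" where
  "torso G W F u v =
     \<lparr>verts = W, edges = insert None (Some ` F), ends = case_option {u, v} (ends G)\<rparr>"

lemma torso_simps [simp]:
  "verts (torso G W F u v) = W" "edges (torso G W F u v) = insert None (Some ` F)"
  "ends (torso G W F u v) None = {u, v}" "ends (torso G W F u v) (Some e) = ends G e"
  by (simp_all add: torso_def)

lemma closed_in_torso:
  "closed_in (torso G W F u v) T P \<longleftrightarrow> P \<subseteq> T \<and>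
     (\<forall>e\<in>F. ends G e \<subseteq> T \<longrightarrow> ends G e \<inter> P \<noteq> {} \<longrightarrow> ends G e \<subseteq> P) \<and>
     (u \<in> T \<longrightarrow> v \<in> T \<longrightarrow> (u \<in> P \<longleftrightarrow> v \<in> P))"
  by (auto simp: closed_in_def)

lemma card_edges_within_torso:
  assumes "finite F"
  shows "card (edges_within (torso G W F u v) X) =
    card {e \<in> F. ends G e \<subseteq> X} + (if u \<in> X \<and> v \<in> X then 1 else 0)"
proof -
  let ?S = "Some ` {e \<in> F. ends G e \<subseteq> X}"
  have "edges_within (torso G W F u v) X = (if u \<in> X \<and> v \<in> X then insert None ?S else ?S)"
    by (auto simp: edges_within_def)
  moreover have "card ?S = card {e \<in> F. ends G e \<subseteq> X}" by (simp add: card_image)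
  ultimately show ?thesis using assms by auto
qed

text \<open>The edge sets are parameters of their own because an edge joining \<open>u\<close> and
  \<open>v\<close> may be assigned to either side.\<close>

locale separation =
  fixes G :: "('v, 'e) mgraph" and V1 V2 :: "'v set" and E1 E2 :: "'e set" and u v :: 'v
  assumes mg: "multigraph G"
    and verts_eq: "verts G = V1 \<union> V2"
    and verts_Int: "V1 \<inter> V2 = {u, v}"
    and u_neq_v: "u \<noteq> v"
    and edges_eq: "edges G = E1 \<union> E2"
    and edges_Int: "E1 \<inter> E2 = {}"
    and ends_E1: "\<And>e. e \<in> E1 \<Longrightarrow> ends G e \<subseteq> V1"
    and ends_E2: "\<And>e. e \<in> E2 \<Longrightarrow> ends G e \<subseteq> V2"
begin

abbreviation G1 :: "('v, 'e option) mgraph" where "G1 \<equiv> torso G V1 E1 u v"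
abbreviation G2 :: "('v, 'e option) mgraph" where "G2 \<equiv> torso G V2 E2 u v"

text \<open>Interpreting the locale a second time through this symmetry yields every statement about
  \<open>G1\<close> also for \<open>G2\<close>.\<close>

lemma separation_swap: "separation G V2 V1 E2 E1 u v"
  using separation_axioms unfolding separation_def by blast

lemma uv: "u \<in> V1" "v \<in> V1" "u \<in> V2" "v \<in> V2"
  using verts_Int by auto

lemma in_both: "x \<in> V1 \<Longrightarrow> x \<in> V2 \<Longrightarrow> x = u \<or> x = v"
  using verts_Int by auto

lemma fin: "finite V1" "finite V2" "finite E1" "finite E2"
  using multigraphD(1,2)[OF mg] verts_eq edges_eq by auto

lemma card_verts_Un: "card (verts G) + 2 = card V1 + card V2"
  using card_Un_Int[OF fin(1,2)] verts_eq verts_Int u_neq_v by simp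

lemma multigraph_torso: "multigraph G1"
  using multigraphD(4)[OF mg] fin ends_E1 edges_eq uv u_neq_v
  by (auto simp: multigraph_def)

lemma card_within:
  "card (edges_within G X) = card {e \<in> E1. ends G e \<subseteq> X} + card {e \<in> E2. ends G e \<subseteq> X}"
proof -
  have "edges_within G X = {e \<in> E1. ends G e \<subseteq> X} \<union> {e \<in> E2. ends G e \<subseteq> X}"
    using edges_eq by (auto simp: edges_within_def)
  then show ?thesis using fin edges_Int by (auto intro!: card_Un_disjoint)
qed

section \<open>Connectedness in a graph and in its torsos\<close>

text \<open>The virtual edge stands for all connections through the other side. A closed set of the
  torso that avoids \<open>u\<close> and \<open>v\<close> is closed in \<open>G\<close>; any other
  one contains all of \<open>S \<inter> {u, v}\<close> and becomes closed in \<open>G\<close> after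
  adding \<open>S \<inter> V2\<close>.\<close>

lemma conn_torso:
  assumes S: "conn G S" "S \<inter> V1 \<noteq> {}" "S \<subseteq> verts G"
  shows "conn G1 (S \<inter> V1)"
proof (rule connI[OF S(2)])
  fix P assume P: "closed_in G1 (S \<inter> V1) P" "P \<noteq> {}"
  have PS: "P \<subseteq> S \<inter> V1" and PE: "\<And>e. e \<in> E1 \<Longrightarrow> ends G e \<subseteq> S \<inter> V1 \<Longrightarrow> ends G e \<inter> P \<noteq> {} \<Longrightarrow> ends G e \<subseteq> P"
    and Puv: "u \<in> S \<Longrightarrow> v \<in> S \<Longrightarrow> u \<in> P \<longleftrightarrow> v \<in> P"
    using P(1) uv unfolding closed_in_torso by auto
  show "P = S \<inter> V1"
  proof (cases "P \<inter> {u, v} = {}")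
    case True
    have "closed_in G S P"
    proof (rule closed_inI)
      fix e x assume e: "e \<in> edges G" "ends G e \<subseteq> S" "x \<in> ends G e" "x \<in> P"
      have "e \<in> E1"
      proof (rule ccontr)
        assume "e \<notin> E1"
        then have "x \<in> V2" using e edges_eq ends_E2 by auto
        then show False using e PS True verts_Int by blast
      qed
      then show "ends G e \<subseteq> P" using PE[of e] ends_E1 e by auto
    qed (use PS in blast)
    then have "P = S" using connD[OF S(1)] P(2) by blast
    then show ?thesis using PS by blast
  next
    case False
    then have K: "S \<inter> {u, v} \<subseteq> P" using Puv PS by auto
    have "closed_in G S (P \<union> (S \<inter> V2))"
    proof (rule closed_inI)
      fix e x assume e: "e \<in> edges G" "ends G e \<subseteq> S" "x \<in> ends G e" "x \<in> P \<union> (S \<inter> V2)"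
      show "ends G e \<subseteq> P \<union> (S \<inter> V2)"
      proof (cases "e \<in> E1")
        case True
        then have "x \<in> P" using e K ends_E1[OF True] verts_Int by blast
        then show ?thesis using PE[OF True] ends_E1[OF True] e by auto
      next
        case False
        then show ?thesis using e edges_eq ends_E2 by auto
      qed
    qed (use PS in blast)
    then have "P \<union> (S \<inter> V2) = S" using connD[OF S(1)] P(2) by blast
    then show ?thesis using PS K verts_Int by blast
  qed
qed

lemma tconn_torso:
  assumes X: "tconn G X" "X \<subseteq> verts G" "2 \<le> card (X \<inter> V1)"
  shows "tconn G1 (X \<inter> V1)"
  unfolding tconn_def
proof (intro conjI ballI)
  have "X \<inter> V1 \<noteq> {}" using X(3) by force
  then show "conn G1 (X \<inter> V1)" using conn_torso tconnD(3)[OF X(1)] X(2) by blast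
  fix z assume z: "z \<in> X \<inter> V1"
  then have "card (X \<inter> V1 - {z}) \<noteq> 0" using X(3) tconnD(2)[OF X(1)] by simp
  moreover have eq: "X \<inter> V1 - {z} = (X - {z}) \<inter> V1" by blast
  ultimately have "(X - {z}) \<inter> V1 \<noteq> {}" by (metis card.empty)
  then have "conn G1 ((X - {z}) \<inter> V1)" using X(2) tconnD(5)[OF X(1)] by (intro conn_torso) auto
  then show "conn G1 (X \<inter> V1 - {z})" using eq by simp
qed (fact X(3))

text \<open>The virtual edge does not lie inside \<open>T\<close>, and every other edge of the torso
  is an edge of \<open>G\<close>.\<close>

lemma conn_of_torso:
  assumes T: "conn G1 T" "\<not> (u \<in> T \<and> v \<in> T)"
  shows "conn G T"
proof (rule connI)
  show "T \<noteq> {}" using T conn_nonempty by blast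
  fix P assume P: "closed_in G T P" "P \<noteq> {}"
  then have "closed_in G1 T P" using T(2) edges_eq by (auto simp: closed_in_torso closed_in_def)
  then show "P = T" using connD[OF T(1)] P(2) by blast
qed

text \<open>A 2-connected graph on at least three vertices has no bridge, so the virtual edge is
  dispensable.\<close>

lemma conn_of_tconn_torso:
  assumes X: "tconn G1 X" "3 \<le> card X"
  shows "conn G X"
proof (rule connI)
  show "X \<noteq> {}" using X by auto
  \<comment> \<open>If only the virtual edge joins \<open>P\<close> to the rest, deleting its end
    \<open>a\<close> in \<open>P\<close> makes the remainder of \<open>P\<close> closed in a
    connected graph that still contains \<open>b\<close>; so the remainder is empty.\<close>
  have aux: "P = {a}"
    if P: "closed_in G X P" "P \<noteq> {}" "P \<noteq> X" and ab: "a \<in> P" "b \<in> X" "b \<notin> P" "{a, b} = {u, v}" for P a b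
  proof -
    have "closed_in G (X - {a}) (P \<inter> (X - {a}))" by (rule closed_in_Int[OF P(1)]) blast
    then have "closed_in G1 (X - {a}) (P \<inter> (X - {a}))"
      using edges_eq ab(4) by (auto simp: closed_in_torso closed_in_def doubleton_eq_iff)
    then have "P \<inter> (X - {a}) = {} \<or> P \<inter> (X - {a}) = X - {a}"
      using tconnD(5)[OF X(1), of a] by (auto simp: conn_def)
    then show ?thesis using ab P closed_in_subset by blast
  qed
  fix P assume P: "closed_in G X P" "P \<noteq> {}"
  show "P = X"
  proof (rule ccontr)
    assume neq: "P \<noteq> X"
    have PX: "P \<subseteq> X" using P closed_in_subset by blast
    have comp: "closed_in G X (X - P)" "X - P \<noteq> {}" "X - P \<noteq> X"
      using closed_in_Diff[OF P(1)] PX neq P(2) by auto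
    have "\<not> closed_in G1 X P" using connD[OF tconnD(3)[OF X(1)]] P(2) neq by blast
    then have uvX: "u \<in> X" "v \<in> X" and "(u \<in> P) \<noteq> (v \<in> P)"
      using P(1) edges_eq by (auto simp: closed_in_torso closed_in_def)
    then consider "u \<in> P" "v \<notin> P" | "v \<in> P" "u \<notin> P" by blast
    \<comment> \<open>The argument applies to \<open>P\<close> and to its complement, leaving
      \<open>X\<close> with no vertices besides \<open>u\<close> and \<open>v\<close>.\<close>
    then have "P \<subseteq> {u, v} \<and> X - P \<subseteq> {u, v}"
    proof cases
      case 1
      then show ?thesis using aux[OF P neq, of u v] aux[OF comp, of v u] uvX by auto
    next
      case 2
      then show ?thesis using aux[OF P neq, of v u] aux[OF comp, of u v] uvX by auto
    qed
    then have "card X \<le> card {u, v}" by (intro card_mono) auto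
    then show False using X(2) u_neq_v by simp
  qed
qed

text \<open>The connected set \<open>T\<close> contains both ends of the virtual edge and takes over
  its role: a set that misses \<open>T\<close> contains neither end, so it cannot be split by that
  edge.\<close>

lemma conn_glue:
  assumes "conn G1 S" "conn G T" "u \<in> T" "v \<in> T" "S \<inter> T \<noteq> {}"
  shows "conn G (S \<union> T)"
proof (rule conn_extend[OF assms(2)])
  fix Q assume Q: "closed_in G (S \<union> T) Q" "Q \<inter> T = {}"
  have QS: "Q \<subseteq> S" using Q closed_in_subset by fastforce
  have "closed_in G1 S Q"
    unfolding closed_in_torso
  proof (intro conjI ballI impI QS)
    fix e assume e: "e \<in> E1" "ends G e \<subseteq> S" "ends G e \<inter> Q \<noteq> {}"
    then obtain x where "x \<in> ends G e" "x \<in> Q" by blast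
    then show "ends G e \<subseteq> Q" using closed_inD[OF Q(1), of e x] e edges_eq by blast
  qed (use Q(2) assms(3,4) in blast)
  then have "Q = {} \<or> Q = S" using assms(1) by (auto simp: conn_def)
  then show "Q = {}" using Q(2) assms(5) by blast
qed auto

section \<open>Tight torsos give a tight graph\<close>

text \<open>The trace on \<open>V1\<close> is a good flat of \<open>G1\<close>. The two shared
  vertices and the two virtual edges balance in the count, so f(X) is the value of
  \<open>X \<inter> V1\<close> in \<open>G1\<close> plus that of \<open>V2\<close> in
  \<open>G2\<close>, namely 1 + 0.\<close>

lemma tight_good_flat_containing_V2:
  assumes t: "tight G1" "tight G2"
    and X: "X \<subset> verts G" "tconn G X" "conn G (verts G - X)" "V2 \<subseteq> X"
  shows "card (edges_within G X) + 3 = 2 * card X"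
proof -
  have fX: "finite X" using tconnD(2)[OF X(2)] .
  have uvX: "u \<in> X \<inter> V1" "v \<in> X \<inter> V1" using uv X(4) by auto
  have "card {u, v} \<le> card (X \<inter> V1)" using uvX fX by (intro card_mono) auto
  then have c2: "2 \<le> card (X \<inter> V1)" using u_neq_v by simp
  have eq: "(verts G - X) \<inter> V1 = V1 - X \<inter> V1" "V1 - X \<inter> V1 \<noteq> {}" using X verts_eq by auto
  have "conn G1 (V1 - X \<inter> V1)" using conn_torso[OF X(3)] eq by auto
  moreover have "tconn G1 (X \<inter> V1)" using tconn_torso X c2 by blast
  moreover have "X \<inter> V1 \<subset> V1" using eq by blast
  ultimately have "card (edges_within G1 (X \<inter> V1)) + 3 = 2 * card (X \<inter> V1)"
    using t(1) by (simp add: tight_def)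
  moreover have "card (edges_within G1 (X \<inter> V1)) = card {e \<in> E1. ends G e \<subseteq> X} + 1"
  proof -
    have "{e \<in> E1. ends G e \<subseteq> X \<inter> V1} = {e \<in> E1. ends G e \<subseteq> X}" using ends_E1 by auto
    then show ?thesis using card_edges_within_torso[OF fin(3), of G V1 u v "X \<inter> V1"] uvX by simp
  qed
  moreover have "{e \<in> E2. ends G e \<subseteq> X} = E2" using ends_E2 X(4) by auto
  then have "card {e \<in> E2. ends G e \<subseteq> X} = card E2" by simp
  moreover have "card E2 + 3 = 2 * card V2"
    using t(2) fin by (simp add: tight_def card_image)
  moreover have "card X + 2 = card (X \<inter> V1) + card V2"
  proof -
    have "(X \<inter> V1) \<union> V2 = X" "(X \<inter> V1) \<inter> V2 = {u, v}" using X verts_eq verts_Int by auto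
    then show ?thesis using card_Un_Int[of "X \<inter> V1" V2] fin u_neq_v by simp
  qed
  ultimately show ?thesis using card_within[of X] by linarith
qed

text \<open>Such an \<open>X\<close> contains neither the virtual edge nor an edge of
  \<open>E2\<close>, so it spans equally many edges in \<open>G\<close> and in \<open>G1\<close>,
  and it is a good flat of both.\<close>

lemma tight_good_flat_within_V1:
  assumes t: "tight G1"
    and X: "X \<subset> verts G" "tconn G X" "conn G (verts G - X)" "X \<subseteq> V1" "\<not> (u \<in> X \<and> v \<in> X)"
  shows "card (edges_within G X) + 3 = 2 * card X"
proof -
  have XV: "X \<inter> V1 = X" "(verts G - X) \<inter> V1 = V1 - X" "V1 - X \<noteq> {}" using X verts_eq uv by auto
  have "tconn G1 X" using tconn_torso[OF X(2)] X(1) tconnD(1)[OF X(2)] XV by auto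
  moreover have "conn G1 (V1 - X)" using conn_torso[OF X(3)] XV by auto
  moreover have "X \<subset> V1" using XV by blast
  ultimately have "card (edges_within G1 X) + 3 = 2 * card X" using t by (simp add: tight_def)
  moreover have "card {e \<in> E2. ends G e \<subseteq> X} = 0"
  proof -
    have False if e: "e \<in> E2" "ends G e \<subseteq> X" for e
    proof -
      have sub: "ends G e \<subseteq> {u, v}" using e ends_E2 X(4) verts_Int by blast
      then have "ends G e = {u, v}" using multigraphD(4)[OF mg, of e] e(1) edges_eq u_neq_v
        by (intro card_subset_eq) auto
      then show False using e X(5) by auto
    qed
    then have "{e \<in> E2. ends G e \<subseteq> X} = {}" by blast
    then show ?thesis by (simp only: card.empty)
  qed
  moreover have "card (edges_within G1 X) = card {e \<in> E1. ends G e \<subseteq> X}"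
    using card_edges_within_torso[OF fin(3), of G V1 u v X] X(5) by auto
  ultimately show ?thesis using card_within[of X] by linarith
qed

text \<open>A good flat either contains \<open>u\<close> and \<open>v\<close>, and then its
  connected complement lies on one side, so that it contains the other side; or it lacks one of
  them, and then it lies within one side.\<close>

theorem tight_of_torsos:
  assumes t: "tight G1" "tight G2"
  shows "tight G"
  unfolding tight_def
proof (intro conjI allI impI)
  interpret swap: separation G V2 V1 E2 E1 u v by (rule separation_swap)
  have "card (edges G) = card E1 + card E2"
    using edges_eq edges_Int fin by (simp add: card_Un_disjoint)
  moreover have "card E1 + 3 = 2 * card V1" "card E2 + 3 = 2 * card V2"
    using t fin by (simp_all add: tight_def card_image)
  ultimately show "card (edges G) + 2 = 2 * card (verts G)" using card_verts_Un by linarith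
  fix X assume "X \<subset> verts G \<and> tconn G X \<and> conn G (verts G - X)"
  then have X: "X \<subset> verts G" "tconn G X" "conn G (verts G - X)" by auto
  show "card (edges_within G X) + 3 = 2 * card X"
  proof (cases "u \<in> X \<and> v \<in> X")
    case True
    have "closed_in G (verts G - X) (V1 - X)"
    proof (rule closed_inI)
      show "V1 - X \<subseteq> verts G - X" using verts_eq by blast
      fix e x assume e: "e \<in> edges G" "ends G e \<subseteq> verts G - X" "x \<in> ends G e" "x \<in> V1 - X"
      have "e \<notin> E2" using ends_E2[of e] e True in_both[of x] by blast
      then show "ends G e \<subseteq> V1 - X" using ends_E1[of e] e edges_eq by blast
    qed
    then have "V1 - X = {} \<or> V1 - X = verts G - X" using X(3) by (auto simp: conn_def)
    moreover have "V2 \<subseteq> X" if "V1 - X = verts G - X"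
    proof
      fix y assume "y \<in> V2"
      then show "y \<in> X" using that verts_eq True in_both[of y] by (cases "y \<in> V1") auto
    qed
    ultimately have "V1 \<subseteq> X \<or> V2 \<subseteq> X" by blast
    then show ?thesis
      using tight_good_flat_containing_V2[OF t X] swap.tight_good_flat_containing_V2[OF t(2,1) X] by blast
  next
    case False
    \<comment> \<open>At most one vertex is removed from the 2-connected set \<open>X\<close>, so
      \<open>Y\<close> stays connected and cannot meet both sides.\<close>
    define Y where "Y = X - {u, v}"
    have "Y = X \<or> Y = X - {u} \<or> Y = X - {v}" using False unfolding Y_def by blast
    then have cY: "conn G Y" using tconnD(3,5)[OF X(2)] by auto
    have "closed_in G Y (Y \<inter> V1)"
    proof (rule closed_inI)
      fix e x assume e: "e \<in> edges G" "ends G e \<subseteq> Y" "x \<in> ends G e" "x \<in> Y \<inter> V1"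
      have "e \<notin> E2" using ends_E2[of e] e in_both[of x] unfolding Y_def by blast
      then show "ends G e \<subseteq> Y \<inter> V1" using ends_E1[of e] e edges_eq by blast
    qed blast
    then have "Y \<inter> V1 = {} \<or> Y \<inter> V1 = Y" using cY by (auto simp: conn_def)
    moreover have "X \<subseteq> Y \<union> {u, v}" "Y \<subseteq> V1 \<union> V2" using X(1) verts_eq unfolding Y_def by auto
    ultimately have "X \<subseteq> V1 \<or> X \<subseteq> V2" using uv by blast
    then show ?thesis
      using tight_good_flat_within_V1[OF t(1) X] swap.tight_good_flat_within_V1[OF t(2) X] False by blast
  qed
qed

section \<open>A tight graph has tight torsos\<close>

lemma tconn_torso_whole: "tconn G (verts G) \<Longrightarrow> tconn G1 V1"
proof -
  assume V: "tconn G (verts G)"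
  have eq: "verts G \<inter> V1 = V1" using verts_eq by blast
  have "card {u, v} \<le> card V1" using uv fin by (intro card_mono) auto
  then show ?thesis using tconn_torso[OF V] eq u_neq_v by simp
qed

text \<open>If the deleted vertex is \<open>u\<close> or \<open>v\<close>, the two remainders are
  connected without the virtual edge and meet in the other one. If it is interior to one side, the
  intact other side replaces the virtual edge.\<close>

lemma tconn_glue:
  assumes V2: "tconn G2 V2" "3 \<le> card V2" and X: "tconn G1 X" "3 \<le> card X" "u \<in> X" "v \<in> X" "X \<subseteq> V1"
  shows "tconn G (X \<union> V2)"
  unfolding tconn_def
proof (intro conjI ballI)
  interpret swap: separation G V2 V1 E2 E1 u v by (rule separation_swap)
  have cX: "conn G X" using conn_of_tconn_torso X by blast
  have cV2: "conn G V2" using swap.conn_of_tconn_torso V2 by blast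
  have "card X \<le> card (X \<union> V2)" using tconnD(2)[OF X(1)] fin by (intro card_mono) auto
  then show "2 \<le> card (X \<union> V2)" using X(2) by linarith
  show "conn G (X \<union> V2)" using conn_Un[OF cX cV2] uv X by blast
  fix y assume y: "y \<in> X \<union> V2"
  consider "y = u \<or> y = v" | "y \<in> X" "y \<notin> V2" | "y \<in> V2" "y \<notin> X"
    using y X(5) verts_Int by blast
  then show "conn G (X \<union> V2 - {y})"
  proof cases
    case 1
    have "conn G (X - {y})" using conn_of_torso[OF tconnD(5)[OF X(1)], of y] 1 by blast
    moreover have "conn G (V2 - {y})" using swap.conn_of_torso[OF tconnD(5)[OF V2(1)], of y] 1 by blast
    moreover have "(X - {y}) \<inter> (V2 - {y}) \<noteq> {}" using 1 X uv u_neq_v by blast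
    ultimately show ?thesis using conn_Un by (metis Un_Diff)
  next
    case 2
    have "conn G ((X - {y}) \<union> V2)"
      by (rule conn_glue) (use tconnD(5)[OF X(1)] cV2 uv X 2 in auto)
    moreover have "(X - {y}) \<union> V2 = X \<union> V2 - {y}" using 2 by blast
    ultimately show ?thesis by simp
  next
    case 3
    have "conn G ((V2 - {y}) \<union> X)"
      by (rule swap.conn_glue) (use tconnD(5)[OF V2(1)] cX uv X 3 in auto)
    moreover have "(V2 - {y}) \<union> X = X \<union> V2 - {y}" using 3 by blast
    ultimately show ?thesis by simp
  qed
qed

theorem tight_torso:
  assumes V: "tconn G (verts G)" and t: "tight G" and c3: "3 \<le> card V1" "3 \<le> card V2"
  shows "tight G1"
  unfolding tight_def torso_simps
proof (intro conjI allI impI)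
  interpret swap: separation G V2 V1 E2 E1 u v by (rule separation_swap)
  have V1: "tconn G1 V1" and V2: "tconn G2 V2"
    using tconn_torso_whole swap.tconn_torso_whole V by blast+
  have cV2: "conn G V2" using swap.conn_of_tconn_torso[OF V2] c3 by blast
  have neq: "V1 \<subset> verts G" "V2 \<subset> verts G"
    using card_verts_Un c3 verts_eq by auto
  then have b: "card (edges_within G V1) + 3 \<le> 2 * card V1" "card (edges_within G V2) + 3 \<le> 2 * card V2"
    using tight_bound[OF mg V t, of V1] tight_bound[OF mg V t, of V2] c3 by linarith+
  have e1: "{e \<in> E1. ends G e \<subseteq> V1} = E1" and e2: "{e \<in> E2. ends G e \<subseteq> V2} = E2"
    using ends_E1 ends_E2 by auto
  have "card (edges G) = card E1 + card E2"
    using edges_eq edges_Int fin by (simp add: card_Un_disjoint)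
  moreover have "card (edges G) + 2 = 2 * card (verts G)" using t by (simp add: tight_def)
  \<comment> \<open>The two bounds add up to |E(V1)| + |E(V2)| \<le> 2|V1| + 2|V2| - 6 = |E1| +
    |E2|. All slack vanishes: both bounds are equalities, and no edge of \<open>E1\<close> joins
    \<open>u\<close> and \<open>v\<close>.\<close>
  ultimately have cE: "card E1 + 3 = 2 * card V1" "card E2 + 3 = 2 * card V2"
    and z: "card {e \<in> E1. ends G e \<subseteq> V2} = 0"
    using card_verts_Un b card_within[of V1] card_within[of V2] unfolding e1 e2 by linarith+
  have E1uv: "{e \<in> E1. ends G e \<subseteq> {u, v}} = {}"
  proof -
    have "{e \<in> E1. ends G e \<subseteq> V2} = {}" using z fin by simp
    then show ?thesis using uv by blast
  qed
  show "card (insert None (Some ` E1)) + 2 = 2 * card V1"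
    using cE fin by (simp add: card_image)
  fix X assume "X \<subset> V1 \<and> tconn G1 X \<and> conn G1 (V1 - X)"
  then have X: "X \<subset> V1" "tconn G1 X" "conn G1 (V1 - X)" by auto
  have n: "card (edges_within G1 X) = card {e \<in> E1. ends G e \<subseteq> X} + (if u \<in> X \<and> v \<in> X then 1 else 0)"
    by (rule card_edges_within_torso[OF fin(3)])
  show "card (edges_within G1 X) + 3 = 2 * card X"
  proof (cases "u \<in> X \<and> v \<in> X")
    case True
    show ?thesis
    proof (cases "X = {u, v}")
      case Xuv: True
      \<comment> \<open>The virtual edge is the only edge here, and 1 + 3 = 2 * 2.\<close>
      then show ?thesis using n E1uv u_neq_v by simp
    next
      case False
      have "card {u, v} < card X" using False True tconnD(2)[OF X(2)] by (intro psubset_card_mono) auto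
      then have X3: "3 \<le> card X" using u_neq_v by simp
      \<comment> \<open>Filling in the whole other side gives a good flat of \<open>G\<close> with
        complement \<open>V1 - X\<close>. This trades the virtual edge for
        \<open>2 * card V2 - 3\<close> edges and adds \<open>card V2 - 2\<close> vertices, which
        leaves f unchanged.\<close>
      let ?Y = "X \<union> V2"
      have "tconn G ?Y" using tconn_glue[OF V2 c3(2) X(2) X3] True X(1) by blast
      moreover have eq: "verts G - ?Y = V1 - X" using verts_eq in_both True by auto
      have "conn G (V1 - X)" using conn_of_torso[OF X(3)] True by blast
      moreover have "?Y \<subset> verts G" using eq verts_eq X(1) by auto
      ultimately have "card (edges_within G ?Y) + 3 = 2 * card ?Y"
        using t eq by (simp add: tight_def)
      moreover have "ends G e \<subseteq> ?Y \<longleftrightarrow> ends G e \<subseteq> X" if "e \<in> E1" for e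
        using ends_E1[OF that] in_both True by blast
      then have "{e \<in> E1. ends G e \<subseteq> ?Y} = {e \<in> E1. ends G e \<subseteq> X}" by blast
      moreover have "{e \<in> E2. ends G e \<subseteq> ?Y} = E2" using ends_E2 by auto
      moreover have "card ?Y + 2 = card X + card V2"
      proof -
        have "X \<inter> V2 = {u, v}" using X(1) in_both True uv by auto
        then show ?thesis using card_Un_Int[OF tconnD(2)[OF X(2)] fin(2)] u_neq_v by simp
      qed
      ultimately show ?thesis using n True cE(2) card_within[of ?Y] by simp
    qed
  next
    case False
    have XV: "X \<subset> verts G" using X(1) neq(1) by (rule psubset_trans)
    have "conn G X" using conn_of_torso[OF tconnD(3)[OF X(2)]] False by blast
    moreover have "conn G (X - {z})" for z using conn_of_torso[OF tconnD(5)[OF X(2)], of z] False by blast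
    ultimately have tX: "tconn G X" using tconnD(1)[OF X(2)] by (simp add: tconn_def)
    \<comment> \<open>If \<open>X\<close> avoids \<open>u\<close> and \<open>v\<close>, all of
      \<open>V2\<close> is in the complement and replaces the virtual edge. If \<open>X\<close>
      contains exactly one of them, the complement is glued from its two sides at the other
      one.\<close>
    have "conn G (verts G - X)"
    proof (cases "u \<in> X \<or> v \<in> X")
      case False
      have "conn G ((V1 - X) \<union> V2)"
        by (rule conn_glue) (use X(3) cV2 uv False in auto)
      moreover have "(V1 - X) \<union> V2 = verts G - X" using verts_eq in_both X(1) False by auto
      ultimately show ?thesis by simp
    next
      case True
      then obtain a where a: "a \<in> {u, v}" "a \<in> X" by blast
      then have aX: "X \<inter> V2 = {a}" using False X(1) in_both uv by auto
      have "conn G (V1 - X)" using conn_of_torso[OF X(3)] True by blast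
      moreover have "conn G (V2 - {a})" using swap.conn_of_torso[OF tconnD(5)[OF V2], of a] a by blast
      moreover have "(V1 - X) \<inter> (V2 - {a}) \<noteq> {}" using a False uv by blast
      ultimately have "conn G ((V1 - X) \<union> (V2 - {a}))" by (rule conn_Un)
      moreover have "(V1 - X) \<union> (V2 - {a}) = verts G - X" using aX verts_eq X(1) by auto
      ultimately show ?thesis by simp
    qed
    then have "card (edges_within G X) + 3 = 2 * card X" using t XV tX by (simp add: tight_def)
    moreover have "card {e \<in> E2. ends G e \<subseteq> X} = 0"
    proof -
      have False if e: "e \<in> E2" "ends G e \<subseteq> X" for e
      proof -
        have sub: "ends G e \<subseteq> {u, v}" using e ends_E2 X(1) verts_Int by blast
        then have "ends G e = {u, v}" using multigraphD(4)[OF mg, of e] e(1) edges_eq u_neq_v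
          by (intro card_subset_eq) auto
        then show False using e False by auto
      qed
      then have "{e \<in> E2. ends G e \<subseteq> X} = {}" by blast
      then show ?thesis by (simp only: card.empty)
    qed
    moreover have "card (edges_within G1 X) = card {e \<in> E1. ends G e \<subseteq> X}" using n False by auto
    ultimately show ?thesis using card_within[of X] by linarith
  qed
qed

end

section \<open>Finding a separation at a cut pair\<close>

lemma separation_of_cut:
  assumes mg: "multigraph G" and V: "tconn G (verts G)" "3 \<le> card (verts G)"
    and v: "v \<in> verts G" "\<not> tconn G (verts G - {v})"
  obtains V1 V2 E1 E2 u where "separation G V1 V2 E1 E2 u v" "3 \<le> card V1" "3 \<le> card V2"
proof -
  let ?V = "verts G"
  have fV: "finite ?V" using mg by (rule multigraphD)
  have "2 \<le> card (?V - {v})" using V(2) v(1) fV by simp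
  \<comment> \<open>\<open>V - {v}\<close> is connected and has two vertices, so only a second cut
    vertex can keep it from being 2-connected.\<close>
  then obtain u where u: "u \<in> ?V" "u \<noteq> v" "\<not> conn G (?V - {v} - {u})"
    using v(2) tconnD(5)[OF V(1), of v] by (auto simp: tconn_def)
  have "card (?V - {v} - {u}) \<noteq> 0" using V(2) v(1) u fV by simp
  then have "?V - {v} - {u} \<noteq> {}" by (metis card.empty)
  then obtain P where P: "closed_in G (?V - {v} - {u}) P" "P \<noteq> {}" "P \<noteq> ?V - {v} - {u}"
    using u(3) unfolding conn_def by blast
  have PV: "P \<subseteq> ?V - {v} - {u}" using P closed_in_subset by blast
  define V1 where "V1 = P \<union> {u, v}"
  define V2 where "V2 = ?V - P"
  \<comment> \<open>All edges joining \<open>u\<close> and \<open>v\<close> go to the first side; an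
    edge left over has an end outside \<open>V1\<close> and therefore cannot meet
    \<open>P\<close>.\<close>
  define E1 where "E1 = edges_within G V1"
  define E2 where "E2 = edges G - E1"
  have E2: "ends G e \<subseteq> V2" if "e \<in> E2" for e
  proof (rule ccontr)
    assume "\<not> ends G e \<subseteq> V2"
    have e: "e \<in> edges G" "\<not> ends G e \<subseteq> V1" using that by (auto simp: E2_def E1_def edges_within_def)
    obtain x where x: "x \<in> ends G e" "x \<in> P"
      using \<open>\<not> ends G e \<subseteq> V2\<close> multigraphD(3)[OF mg e(1)] unfolding V2_def by blast
    obtain y where y: "ends G e = {x, y}" using ends_obtain[OF mg e(1) x(1)] by blast
    then have "y \<notin> V1" using e(2) x(2) V1_def by auto
    moreover have "ends G e \<subseteq> ?V - {v} - {u}"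
      using multigraphD(3)[OF mg e(1)] y \<open>y \<notin> V1\<close> x PV by (auto simp: V1_def)
    ultimately show False using closed_inD[OF P(1) e(1) _ x] y by (auto simp: V1_def)
  qed
  have "separation G V1 V2 E1 E2 u v"
    using mg E2 u v(1) PV by unfold_locales (auto simp: V1_def V2_def E1_def E2_def edges_within_def)
  moreover have "3 \<le> card V1"
  proof -
    obtain p where "p \<in> P" using P(2) by blast
    then have "card {p, u, v} \<le> card V1"
      using PV fV u v by (intro card_mono) (auto simp: V1_def intro: finite_subset)
    moreover have "p \<noteq> u" "p \<noteq> v" using \<open>p \<in> P\<close> PV by auto
    ultimately show ?thesis using u(2) by simp
  qed
  moreover have "3 \<le> card V2"
  proof -
    obtain p where p: "p \<in> ?V - {v} - {u}" "p \<notin> P" using P(3) PV by blast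
    then have "card {p, u, v} \<le> card V2"
      using PV fV u v by (intro card_mono) (auto simp: V2_def)
    then show ?thesis using p u(2) by auto
  qed
  ultimately show ?thesis by (rule that)
qed

section \<open>Isomorphisms\<close>

lemma mgraph_isoE:
  assumes "mgraph_iso G H"
  obtains f g where "multigraph G" "multigraph H" "bij_betw f (verts G) (verts H)"
    "bij_betw g (edges G) (edges H)" "\<And>e. e \<in> edges G \<Longrightarrow> ends H (g e) = f ` ends G e"
  using assms unfolding mgraph_iso_def by blast

text \<open>The bijections carry well-formedness from \<open>G\<close> over to
  \<open>H\<close>.\<close>

lemma mgraph_isoI:
  assumes G: "multigraph G" and f: "bij_betw f (verts G) (verts H)"
    and g: "bij_betw g (edges G) (edges H)"
    and e: "\<And>e. e \<in> edges G \<Longrightarrow> ends H (g e) = f ` ends G e"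
  shows "mgraph_iso G H"
proof -
  have "multigraph H"
    unfolding multigraph_def
  proof (intro conjI ballI)
    show "finite (verts H)" "finite (edges H)"
      using bij_betw_finite f g multigraphD(1,2)[OF G] by blast+
    fix e' assume "e' \<in> edges H"
    then obtain d where d: "d \<in> edges G" "e' = g d" using g by (auto simp: bij_betw_def)
    have sub: "ends G d \<subseteq> verts G" using multigraphD(3)[OF G d(1)] .
    then show "ends H e' \<subseteq> verts H" using e[OF d(1)] d(2) f by (auto simp: bij_betw_def)
    have "inj_on f (ends G d)" using f sub by (auto simp: bij_betw_def intro: inj_on_subset)
    then show "card (ends H e') = 2" using e[OF d(1)] d multigraphD(4)[OF G d(1)] by (simp add: card_image)
  qed
  then show ?thesis using assms unfolding mgraph_iso_def by blast
qed

lemma mgraph_iso_sym: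
  assumes "mgraph_iso G H"
  shows "mgraph_iso H G"
  using assms
proof (rule mgraph_isoE)
  fix f g assume *: "multigraph G" "multigraph H" "bij_betw f (verts G) (verts H)"
    "bij_betw g (edges G) (edges H)" "\<And>e. e \<in> edges G \<Longrightarrow> ends H (g e) = f ` ends G e"
  show ?thesis
  proof (rule mgraph_isoI[OF *(2) bij_betw_inv_into[OF *(3)] bij_betw_inv_into[OF *(4)]])
    fix e assume e: "e \<in> edges H"
    let ?d = "inv_into (edges G) g e"
    have d: "?d \<in> edges G" "g ?d = e"
      using e *(4) by (auto simp: bij_betw_def inv_into_into f_inv_into_f)
    have sub: "ends G ?d \<subseteq> verts G" using multigraphD(3)[OF *(1) d(1)] .
    have "ends H e = f ` ends G ?d" using *(5)[OF d(1)] d(2) by simp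
    then show "ends G ?d = inv_into (verts G) f ` ends H e"
      using inv_into_image_cancel[of f "verts G" "ends G ?d"] sub *(3) by (simp add: bij_betw_def)
  qed
qed

text \<open>\<open>K4_class\<close> lives on natural numbers, whereas torsos have edges of option
  type; this moves them back.\<close>

lemma mgraph_iso_nat:
  fixes G :: "('v, 'e) mgraph"
  assumes G: "multigraph G"
  obtains H :: "(nat, nat) mgraph" where "mgraph_iso G H"
proof -
  obtain f :: "'v \<Rightarrow> nat" where f: "bij_betw f (verts G) {0..<card (verts G)}"
    using ex_bij_betw_finite_nat multigraphD(1)[OF G] by blast
  obtain g :: "'e \<Rightarrow> nat" where g: "bij_betw g (edges G) {0..<card (edges G)}"
    using ex_bij_betw_finite_nat multigraphD(2)[OF G] by blast
  let ?H = "\<lparr>verts = {0..<card (verts G)}, edges = {0..<card (edges G)},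
    ends = (\<lambda>i. f ` ends G (inv_into (edges G) g i))\<rparr>"
  have "mgraph_iso G ?H"
    by (rule mgraph_isoI[OF G]) (use f g in \<open>auto simp: bij_betw_def\<close>)
  then show ?thesis by (rule that)
qed

lemma conn_image:
  assumes ends: "\<And>e. e \<in> edges G \<Longrightarrow> g e \<in> edges H \<and> ends H (g e) = f ` ends G e"
    and S: "conn G S"
  shows "conn H (f ` S)"
proof (rule connI)
  show "f ` S \<noteq> {}" using conn_nonempty[OF S] by blast
  fix P assume P: "closed_in H (f ` S) P" "P \<noteq> {}"
  let ?Q = "{x \<in> S. f x \<in> P}"
  have "closed_in G S ?Q"
  proof (rule closed_inI)
    fix e x assume e: "e \<in> edges G" "ends G e \<subseteq> S" "x \<in> ends G e" "x \<in> ?Q"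
    have "ends H (g e) = f ` ends G e" "g e \<in> edges H" using ends[OF e(1)] by auto
    then have "f ` ends G e \<subseteq> P"
      using closed_inD[OF P(1), of "g e" "f x"] e(3,4) image_mono[OF e(2), of f] by auto
    then show "ends G e \<subseteq> ?Q" using e(2) by blast
  qed blast
  moreover have "?Q \<noteq> {}" using P closed_in_subset by fastforce
  ultimately have "?Q = S" using connD[OF S] by blast
  then show "P = f ` S" using closed_in_subset[OF P(1)] by blast
qed

lemma tconn_image:
  assumes ends: "\<And>e. e \<in> edges G \<Longrightarrow> g e \<in> edges H \<and> ends H (g e) = f ` ends G e"
    and S: "tconn G S" and inj: "inj_on f S"
  shows "tconn H (f ` S)"
  unfolding tconn_def
proof (intro conjI ballI)
  show "2 \<le> card (f ` S)" using tconnD(1)[OF S] inj by (simp add: card_image)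
  show "conn H (f ` S)" by (rule conn_image[where g = g]) (use ends tconnD(3)[OF S] in auto)
  fix y assume "y \<in> f ` S"
  then obtain z where z: "z \<in> S" "y = f z" by blast
  then have eq: "f ` S - {y} = f ` (S - {z})" using inj by (auto simp: inj_on_def)
  show "conn H (f ` S - {y})"
    unfolding eq by (rule conn_image[where g = g]) (use ends tconnD(5)[OF S] in auto)
qed

lemma two_connected_iso:
  assumes "mgraph_iso G H" "two_connected G"
  shows "two_connected H"
proof -
  obtain f g where *: "multigraph H" "bij_betw f (verts G) (verts H)"
    "bij_betw g (edges G) (edges H)" "\<And>e. e \<in> edges G \<Longrightarrow> ends H (g e) = f ` ends G e"
    using mgraph_isoE[OF assms(1)] by metis
  have "tconn H (f ` verts G)"
    by (rule tconn_image[where g = g])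
      (use * assms(2) in \<open>auto simp: two_connected_iff_tconn bij_betw_def\<close>)
  then show ?thesis using * by (auto simp: two_connected_iff_tconn bij_betw_def)
qed

lemma card_verts_iso: "mgraph_iso G H \<Longrightarrow> card (verts G) = card (verts H)"
  by (auto simp: mgraph_iso_def bij_betw_same_card)

text \<open>Tightness is pulled back from \<open>H\<close> to \<open>G\<close>, using that the image
  of a good flat of \<open>G\<close> is a good flat of \<open>H\<close> spanning equally many
  edges.\<close>

lemma tight_iso:
  assumes "mgraph_iso G H" "tight H"
  shows "tight G"
proof -
  obtain f g where *: "multigraph G" "multigraph H" "bij_betw f (verts G) (verts H)"
    "bij_betw g (edges G) (edges H)" "\<And>e. e \<in> edges G \<Longrightarrow> ends H (g e) = f ` ends G e"
    using mgraph_isoE[OF assms(1)] by metis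
  have inj: "inj_on f (verts G)" and img: "f ` verts G = verts H"
    and injg: "inj_on g (edges G)" and imgg: "g ` edges G = edges H"
    using *(3,4) by (auto simp: bij_betw_def)
  have ends: "\<And>e. e \<in> edges G \<Longrightarrow> g e \<in> edges H \<and> ends H (g e) = f ` ends G e"
    using imgg *(5) by blast
  show ?thesis
    unfolding tight_def
  proof (intro conjI allI impI)
    show "card (edges G) + 2 = 2 * card (verts G)"
      using assms(2) bij_betw_same_card[OF *(3)] bij_betw_same_card[OF *(4)] by (simp add: tight_def)
    fix S assume "S \<subset> verts G \<and> tconn G S \<and> conn G (verts G - S)"
    then have S: "S \<subset> verts G" "tconn G S" "conn G (verts G - S)" by auto
    have injS: "inj_on f S" using inj S(1) by (auto intro: inj_on_subset)
    have "tconn H (f ` S)" by (rule tconn_image[where g = g, OF ends S(2) injS])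
    moreover have eq: "f ` (verts G - S) = verts H - f ` S"
      using inj_on_image_set_diff[OF inj, of "verts G" S] S(1) img by auto
    have "conn H (f ` (verts G - S))" by (rule conn_image[where g = g, OF ends S(3)])
    moreover have "f ` S \<subset> verts H" using conn_nonempty[OF S(3)] eq img S(1) by blast
    ultimately have "card (edges_within H (f ` S)) + 3 = 2 * card (f ` S)"
      using assms(2) eq by (simp add: tight_def)
    moreover have "edges_within H (f ` S) = g ` edges_within G S"
    proof -
      have "ends H (g e) \<subseteq> f ` S \<longleftrightarrow> ends G e \<subseteq> S" if "e \<in> edges G" for e
      proof -
        have "x \<in> S" if "x \<in> ends G e" "f x \<in> f ` S" for x
          using that inj_on_image_mem_iff[OF inj, of x S] multigraphD(3)[OF *(1) \<open>e \<in> edges G\<close>] S(1) by blast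
        then show ?thesis using *(5)[OF that] by auto
      qed
      then show ?thesis unfolding edges_within_def imgg[symmetric] by blast
    qed
    moreover have "card (g ` edges_within G S) = card (edges_within G S)"
      by (rule card_image) (use injg in \<open>auto simp: edges_within_def intro: inj_on_subset\<close>)
    ultimately show "card (edges_within G S) + 3 = 2 * card S" using injS by (simp add: card_image)
  qed
qed

section \<open>The base cases\<close>

text \<open>There are no good flats: a proper subset has at most one vertex.\<close>

lemma tight_C2: "tight C2"
  unfolding tight_def
proof (intro conjI allI impI)
  fix S assume "S \<subset> verts C2 \<and> tconn C2 S \<and> conn C2 (verts C2 - S)"
  then have S: "S \<subset> verts C2" "2 \<le> card S" using tconnD(1) by auto
  have "card S < card (verts C2)" using psubset_card_mono[OF _ S(1)] by (simp add: C2_def)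
  then show "card (edges_within C2 S) + 3 = 2 * card S" using S(2) by (simp add: C2_def)
qed (simp add: C2_def)

text \<open>Each edge has the whole vertex set as its ends, so arbitrary bijections on vertices and
  edges are compatible.\<close>

lemma mgraph_iso_C2:
  assumes G: "multigraph G" "card (verts G) = 2" "tight G"
  shows "mgraph_iso G C2"
proof -
  have "card (edges G) = 2" using G by (simp add: tight_def)
  moreover have "card (verts C2) = 2" "card (edges C2) = 2" by (simp_all add: C2_def)
  ultimately obtain f g where f: "bij_betw f (verts G) (verts C2)" and g: "bij_betw g (edges G) (edges C2)"
    using finite_same_card_bij[of "verts G" "verts C2"] finite_same_card_bij[of "edges G" "edges C2"]
      multigraphD(1,2)[OF G(1)] G(2) by (metis card.infinite zero_neq_numeral)
  show ?thesis
  proof (rule mgraph_isoI[OF G(1) f g])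
    fix e assume "e \<in> edges G"
    then have "ends G e = verts G"
      using multigraphD[OF G(1)] G(2) by (intro card_subset_eq) auto
    then have "f ` ends G e = verts C2" using f by (simp add: bij_betw_def)
    then show "ends C2 (g e) = f ` ends G e" by (simp add: C2_def)
  qed
qed

lemma card_edges_K4: "card (edges K4) = 6"
  using n_subsets[of "{0..<4::nat}" 2] by (simp add: K4_def eval_nat_numeral)

text \<open>A good flat has k = 2 or k = 3 vertices, and for these values k choose 2 equals 2k -
  3.\<close>

lemma tight_K4: "tight K4"
  unfolding tight_def
proof (intro conjI allI impI)
  show "card (edges K4) + 2 = 2 * card (verts K4)" unfolding card_edges_K4 by (simp add: K4_def)
  fix S assume S: "S \<subset> verts K4 \<and> tconn K4 S \<and> conn K4 (verts K4 - S)"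
  have "edges_within K4 S = {s. s \<subseteq> S \<and> card s = 2}" using S by (auto simp: K4_def edges_within_def)
  moreover have "finite S" "2 \<le> card S" using S tconnD by auto
  moreover have "card S < 4" using S psubset_card_mono[of "verts K4" S] by (simp add: K4_def)
  ultimately have "card (edges_within K4 S) = card S choose 2" "card S = 2 \<or> card S = 3"
    using n_subsets[of S 2] by auto
  then show "card (edges_within K4 S) + 3 = 2 * card S" by (auto simp: eval_nat_numeral)
qed

lemma mgraph_iso_K4:
  assumes mg: "multigraph G" and t: "tight G" and V: "3 \<le> card (verts G)"
    and tc: "\<And>v. v \<in> verts G \<Longrightarrow> tconn G (verts G - {v})"
  shows "mgraph_iso G K4"
proof -
  let ?V = "verts G" and ?E = "edges G"
  have fV: "finite ?V" and fE: "finite ?E" using multigraphD[OF mg] by auto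
  have cE: "card ?E + 2 = 2 * card ?V" using t by (simp add: tight_def)
  \<comment> \<open>The complement of \<open>v\<close> is a good flat, so f rises from 0 to 1 when
    \<open>v\<close> is removed; this means that the degree is 3.\<close>
  have deg: "card {e \<in> ?E. v \<in> ends G e} = 3" if v: "v \<in> ?V" for v
  proof -
    have "?V - {v} \<subset> ?V" "?V - (?V - {v}) = {v}" using v by auto
    then have "card (edges_within G (?V - {v})) + 3 = 2 * card (?V - {v})"
      using t tc[OF v] conn_singleton[of G v] by (simp add: tight_def)
    moreover have "card (?V - {v}) + 1 = card ?V" using v fV V by simp
    moreover have "card ?E = card (edges_within G (?V - {v})) + card {e \<in> ?E. v \<in> ends G e}"
    proof -
      have "?E = edges_within G (?V - {v}) \<union> {e \<in> ?E. v \<in> ends G e}"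
        using multigraphD(3)[OF mg] by (auto simp: edges_within_def)
      moreover have "edges_within G (?V - {v}) \<inter> {e \<in> ?E. v \<in> ends G e} = {}"
        by (auto simp: edges_within_def)
      ultimately show ?thesis
        using card_Un_disjoint[of "edges_within G (?V - {v})" "{e \<in> ?E. v \<in> ends G e}"]
          fE finite_edges_within[OF mg] by simp
    qed
    ultimately show ?thesis using cE by linarith
  qed
  have "(\<Sum>v\<in>?V. card {e \<in> ?E. v \<in> ends G e}) = 2 * card ?E"
  proof (rule sum_multicount[OF fV fE], rule ballI)
    fix e assume e: "e \<in> ?E"
    have "{v \<in> ?V. v \<in> ends G e} = ends G e" using multigraphD(3)[OF mg e] by blast
    then show "card {v \<in> ?V. v \<in> ends G e} = 2" using multigraphD(4)[OF mg e] by simp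
  qed
  \<comment> \<open>Double counting gives 3|V| = 2|E| = 4|V| - 4.\<close>
  then have n4: "card ?V = 4" and e6: "card ?E = 6" using deg cE by simp_all
  have pairs: "\<exists>e\<in>?E. ends G e = {x, y}" if xy: "x \<in> ?V" "y \<in> ?V" "x \<noteq> y" for x y
  proof (rule ccontr)
    assume none: "\<not> ?thesis"
    \<comment> \<open>Deleting the other two vertices one after the other leaves
      \<open>{x, y}\<close> connected, which requires an edge between them.\<close>
    have "card (?V - {x, y}) = 2" using xy n4 fV by (simp add: card_Diff_subset)
    then obtain a b where ab: "?V - {x, y} = {a, b}" "a \<noteq> b" by (auto simp: card_2_iff)
    then have "a \<in> ?V" "?V - {a} - {b} = {x, y}" using xy by auto
    then have c: "conn G {x, y}" using tconnD(5)[OF tc, of a b] by simp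
    have "closed_in G {x, y} {x}"
    proof (rule closed_inI)
      fix e z assume e: "e \<in> ?E" "ends G e \<subseteq> {x, y}"
      have "ends G e = {x, y}"
        using e multigraphD(4)[OF mg e(1)] xy(3) by (intro card_subset_eq) auto
      then show "ends G e \<subseteq> {x}" using none e(1) by blast
    qed auto
    then have "{x} = {x, y}" using connD[OF c] by blast
    then show False using xy(3) by blast
  qed
  have img: "ends G ` ?E = {s. s \<subseteq> ?V \<and> card s = 2}"
  proof
    show "ends G ` ?E \<subseteq> {s. s \<subseteq> ?V \<and> card s = 2}" using multigraphD(3,4)[OF mg] by auto
    show "{s. s \<subseteq> ?V \<and> card s = 2} \<subseteq> ends G ` ?E" using pairs by (fastforce simp: card_2_iff)
  qed
  \<comment> \<open>Six edges cover six pairs, which excludes parallel edges.\<close>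
  have "card (ends G ` ?E) = card ?E"
    unfolding img e6 using n_subsets[OF fV, of 2] n4 by (simp add: eval_nat_numeral)
  then have inj: "inj_on (ends G) ?E" using fE by (rule eq_card_imp_inj_on[rotated])
  have "card ?V = card (verts K4)" "finite (verts K4)" using n4 by (simp_all add: K4_def)
  then obtain f where f: "bij_betw f ?V (verts K4)" using finite_same_card_bij[OF fV] by blast
  then have injf: "inj_on f ?V" by (simp add: bij_betw_def)
  show ?thesis
  proof (rule mgraph_isoI[OF mg f])
    let ?g = "\<lambda>e. f ` ends G e"
    have ig: "inj_on ?g ?E"
    proof (rule inj_onI)
      fix d e assume "d \<in> ?E" "e \<in> ?E" "f ` ends G d = f ` ends G e"
      then show "d = e"
        using inj_on_image_eq_iff[OF injf] multigraphD(3)[OF mg] inj by (metis inj_onD)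
    qed
    have "?g ` ?E \<subseteq> edges K4"
    proof
      fix s assume "s \<in> ?g ` ?E"
      then obtain e where e: "e \<in> ?E" "s = f ` ends G e" by blast
      then have "card s = 2" using multigraphD(3,4)[OF mg e(1)] injf by (simp add: card_image inj_on_subset)
      moreover have "s \<subseteq> verts K4" using e multigraphD(3)[OF mg e(1)] f by (auto simp: bij_betw_def)
      ultimately show "s \<in> edges K4" by (simp add: K4_def)
    qed
    moreover have "finite (edges K4)" using card_edges_K4 card.infinite by fastforce
    moreover have "card (?g ` ?E) = card (edges K4)" using card_image[OF ig] e6 card_edges_K4 by simp
    ultimately have "?g ` ?E = edges K4" by (intro card_subset_eq)
    then show "bij_betw ?g ?E (edges K4)" using ig by (simp add: bij_betw_def)
  qed (simp add: K4_def)
qed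

section \<open>Construction A\<close>

text \<open>The two parts are recovered as torsos: the virtual edge on each side restores the
  deleted glued edge.\<close>

lemma construction_A_separation:
  assumes A: "construction_A \<delta> G1 G2 H" and H: "multigraph H"
  obtains V1 V2 E1 E2 u v where "separation H V1 V2 E1 E2 u v"
    "mgraph_iso (torso H V1 E1 u v) G1" "mgraph_iso (torso H V2 E2 u v) G2"
proof -
  obtain e1 e2 a1 b1 a2 b2 where
    mg: "multigraph G1" "multigraph G2" and
    e: "e1 \<in> edges G1" "ends G1 e1 = {a1, b1}" "e2 \<in> edges G2" "ends G2 e2 = {a2, b2}" and
    H_eq: "H = delete_edges
              (identify_verts (id(Inr a2 := Inl a1, Inr b2 := Inl b1)) (disjoint_union G1 G2))
              {Inl e1, Inr e2}"
    using A unfolding construction_A_def two_connected_def by metis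
  define q where "q = (id(Inr a2 := Inl a1, Inr b2 := Inl b1) :: 'a + 'c \<Rightarrow> 'a + 'c)"
  have ab: "a1 \<noteq> b1" "a2 \<noteq> b2"
    using multigraphD(4)[OF mg(1) e(1)] multigraphD(4)[OF mg(2) e(3)] e by auto
  have abV: "a1 \<in> verts G1" "b1 \<in> verts G1" "a2 \<in> verts G2" "b2 \<in> verts G2"
    using multigraphD(3)[OF mg(1) e(1)] multigraphD(3)[OF mg(2) e(3)] e by auto
  have q: "q (Inl x) = Inl x" "q (Inr a2) = Inl a1" "q (Inr b2) = Inl b1"
    "y \<noteq> a2 \<Longrightarrow> y \<noteq> b2 \<Longrightarrow> q (Inr y) = Inr y" for x y
    using ab by (simp_all add: q_def)
  have vH: "verts H = q ` (verts G1 <+> verts G2)"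
    and eH: "edges H = (edges G1 <+> edges G2) - {Inl e1, Inr e2}"
    and endsH: "ends H (Inl d) = q ` Inl ` ends G1 d" "ends H (Inr d') = q ` Inr ` ends G2 d'" for d d'
    unfolding H_eq q_def by (simp_all add: delete_edges_def identify_verts_def disjoint_union_def)
  have endsH1: "ends H (Inl d) = Inl ` ends G1 d" for d
    unfolding endsH by (auto simp: q image_iff)
  let ?V1 = "Inl ` verts G1" and ?V2 = "q ` Inr ` verts G2"
  let ?E1 = "Inl ` (edges G1 - {e1})" and ?E2 = "Inr ` (edges G2 - {e2})"
  have sep: "separation H ?V1 ?V2 ?E1 ?E2 (Inl a1) (Inl b1)"
  proof
    show "verts H = ?V1 \<union> ?V2"
      unfolding vH Plus_def image_Un by (simp add: image_image q)
    show "?V1 \<inter> ?V2 = {Inl a1, Inl b1}"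
    proof
      show "?V1 \<inter> ?V2 \<subseteq> {Inl a1, Inl b1}"
      proof
        fix z assume z: "z \<in> ?V1 \<inter> ?V2"
        then obtain x y where "z = Inl x" "z = q (Inr y)" by blast
        then show "z \<in> {Inl a1, Inl b1}" using q(2,3) q(4)[of y] by (cases "y = a2 \<or> y = b2") auto
      qed
      show "{Inl a1, Inl b1} \<subseteq> ?V1 \<inter> ?V2" using abV q(2,3) by (auto simp: image_iff) (metis, metis)
    qed
    show "edges H = ?E1 \<union> ?E2" unfolding eH by auto
    show "?E1 \<inter> ?E2 = {}" by auto
    show "ends H d \<subseteq> ?V1" if "d \<in> ?E1" for d using that endsH1 multigraphD(3)[OF mg(1)] by fastforce
    show "ends H d \<subseteq> ?V2" if "d \<in> ?E2" for d using that endsH multigraphD(3)[OF mg(2)] by fastforce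
  qed (use H ab in auto)
  interpret separation H ?V1 ?V2 ?E1 ?E2 "Inl a1" "Inl b1" by (rule sep)
  interpret swap: separation H ?V2 ?V1 ?E2 ?E1 "Inl a1" "Inl b1" by (rule separation_swap)
  have "mgraph_iso (torso H ?V1 ?E1 (Inl a1) (Inl b1)) G1"
  proof (rule mgraph_isoI[OF multigraph_torso])
    show "bij_betw projl (verts (torso H ?V1 ?E1 (Inl a1) (Inl b1))) (verts G1)"
      by (rule bij_betw_byWitness[where f' = Inl]) auto
    show "bij_betw (case_option e1 projl) (edges (torso H ?V1 ?E1 (Inl a1) (Inl b1))) (edges G1)"
      by (rule bij_betw_byWitness[where f' = "\<lambda>d. if d = e1 then None else Some (Inl d)"]) (use e in auto)
    fix d assume "d \<in> edges (torso H ?V1 ?E1 (Inl a1) (Inl b1))"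
    then show "ends G1 (case_option e1 projl d) = projl ` ends (torso H ?V1 ?E1 (Inl a1) (Inl b1)) d"
      using e endsH1 by (auto simp: image_image)
  qed
  moreover have "mgraph_iso (torso H ?V2 ?E2 (Inl a1) (Inl b1)) G2"
  proof -
    \<comment> \<open>A left inverse of \<open>q\<close> on the second side: the glued vertices
      return to \<open>a2\<close> and \<open>b2\<close>.\<close>
    define f where "f = case_sum (\<lambda>x. if x = a1 then a2 else b2) (\<lambda>y::'c. y)"
    have fq: "f (q (Inr y)) = y" for y
      using q(2,3) q(4)[of y] ab by (cases "y = a2"; cases "y = b2") (auto simp: f_def)
    show ?thesis
    proof (rule mgraph_isoI[OF swap.multigraph_torso])
      show "bij_betw f (verts (torso H ?V2 ?E2 (Inl a1) (Inl b1))) (verts G2)"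
        by (rule bij_betw_byWitness[where f' = "\<lambda>y. q (Inr y)"]) (auto simp: fq)
      show "bij_betw (case_option e2 projr) (edges (torso H ?V2 ?E2 (Inl a1) (Inl b1))) (edges G2)"
        by (rule bij_betw_byWitness[where f' = "\<lambda>d. if d = e2 then None else Some (Inr d)"]) (use e in auto)
      fix d assume "d \<in> edges (torso H ?V2 ?E2 (Inl a1) (Inl b1))"
      then show "ends G2 (case_option e2 projr d) = f ` ends (torso H ?V2 ?E2 (Inl a1) (Inl b1)) d"
        using e endsH ab by (auto simp: image_image fq) (auto simp: f_def)
    qed
  qed
  ultimately show ?thesis using that sep by blast
qed

text \<open>Gluing the copies of the two virtual edges and deleting the result leaves exactly copies
  of \<open>E1\<close> and \<open>E2\<close>, attached at \<open>u\<close> and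
  \<open>v\<close>.\<close>

lemma (in separation) construction_A_of_torsos:
  assumes A: "two_connected A1" "two_connected A2"
    and iso: "mgraph_iso G1 A1" "mgraph_iso G2 A2"
  obtains H where "construction_A 2 A1 A2 H" "mgraph_iso G H"
proof -
  obtain f1 g1 where 1: "bij_betw f1 V1 (verts A1)" "bij_betw g1 (insert None (Some ` E1)) (edges A1)"
    and ends1: "\<And>e. e \<in> edges G1 \<Longrightarrow> ends A1 (g1 e) = f1 ` ends G1 e"
    using mgraph_isoE[OF iso(1)] unfolding torso_simps by metis
  obtain f2 g2 where 2: "bij_betw f2 V2 (verts A2)" "bij_betw g2 (insert None (Some ` E2)) (edges A2)"
    and ends2: "\<And>e. e \<in> edges G2 \<Longrightarrow> ends A2 (g2 e) = f2 ` ends G2 e"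
    using mgraph_isoE[OF iso(2)] unfolding torso_simps by metis
  define q where "q = id(Inr (f2 u) := Inl (f1 u), Inr (f2 v) := Inl (f1 v))"
  define H where "H = delete_edges (identify_verts q (disjoint_union A1 A2)) {Inl (g1 None), Inr (g2 None)}"
  have e1: "ends A1 (g1 None) = {f1 u, f1 v}" "g1 None \<in> edges A1"
    and e2: "ends A2 (g2 None) = {f2 u, f2 v}" "g2 None \<in> edges A2"
    using ends1[of None] ends2[of None] 1(2) 2(2) by (auto simp: bij_betw_def)
  have w: "weight_function 2 A1 (\<lambda>_. 1)" "weight_function 2 A2 (\<lambda>_. 1)"
    by (simp_all add: weight_function_def)
  have "construction_A 2 A1 A2 H"
    unfolding construction_A_def
  proof (intro conjI A)
    show "\<exists>w1 w2 e1 e2 a1 b1 a2 b2.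
        weight_function 2 A1 w1 \<and> e1 \<in> edges A1 \<and> w1 e1 = 1 \<and> ends A1 e1 = {a1, b1} \<and>
        weight_function 2 A2 w2 \<and> e2 \<in> edges A2 \<and> w2 e2 = 2 - 1 \<and> ends A2 e2 = {a2, b2} \<and>
        H = delete_edges
              (identify_verts (id(Inr a2 := Inl a1, Inr b2 := Inl b1)) (disjoint_union A1 A2))
              {Inl e1, Inr e2}"
      by (rule exI[of _ "\<lambda>_. 1"], rule exI[of _ "\<lambda>_. 1"], rule exI[of _ "g1 None"],
          rule exI[of _ "g2 None"], rule exI[of _ "f1 u"], rule exI[of _ "f1 v"],
          rule exI[of _ "f2 u"], rule exI[of _ "f2 v"]) (use w e1 e2 H_def q_def in simp)
  qed
  \<comment> \<open>On the overlap \<open>{u, v}\<close> the left copy is chosen; this matches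
    \<open>q\<close>, which redirects the right copies of \<open>u\<close> and \<open>v\<close> to
    the left ones.\<close>
  define f where "f x = (if x \<in> V1 then Inl (f1 x) else Inr (f2 x))" for x
  define g where "g e = (if e \<in> E1 then Inl (g1 (Some e)) else Inr (g2 (Some e)))" for e
  have injf: "inj_on f1 V1" "inj_on f2 V2" and imf: "f1 ` V1 = verts A1" "f2 ` V2 = verts A2"
    using 1 2 by (auto simp: bij_betw_def)
  have injg: "inj_on g1 (insert None (Some ` E1))" "inj_on g2 (insert None (Some ` E2))"
    and img: "g1 ` insert None (Some ` E1) = edges A1" "g2 ` insert None (Some ` E2) = edges A2"
    using 1 2 by (auto simp: bij_betw_def)
  have fV1: "f x = q (Inl (f1 x))" if "x \<in> V1" for x using that by (simp add: f_def q_def)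
  have fV2: "f x = q (Inr (f2 x))" if x: "x \<in> V2" for x
  proof -
    have inj2: "f2 y = f2 z \<longleftrightarrow> y = z" if "y \<in> V2" "z \<in> V2" for y z
      using that injf(2) by (auto simp: inj_on_def)
    show ?thesis
    proof (cases "x \<in> V1")
      case True
      then show ?thesis using in_both[OF True x] inj2 uv u_neq_v by (auto simp: f_def q_def)
    next
      case False
      then have "x \<noteq> u" "x \<noteq> v" using uv by auto
      then show ?thesis using False inj2 x uv by (auto simp: f_def q_def)
    qed
  qed
  have "mgraph_iso G H"
  proof (rule mgraph_isoI[OF mg])
    have "verts H = q ` Inl ` verts A1 \<union> q ` Inr ` verts A2"
      unfolding H_def delete_edges_def identify_verts_def disjoint_union_def Plus_def
      by (simp add: image_Un)
    also have "q ` Inl ` verts A1 = f ` V1"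
      unfolding imf[symmetric] image_image by (intro image_cong) (use fV1 in auto)
    also have "q ` Inr ` verts A2 = f ` V2"
      unfolding imf[symmetric] image_image by (intro image_cong) (use fV2 in auto)
    finally have "f ` verts G = verts H" unfolding verts_eq by (simp add: image_Un)
    moreover have "inj_on f (verts G)"
      unfolding verts_eq using injf by (auto simp: inj_on_def f_def)
    ultimately show "bij_betw f (verts G) (verts H)" by (simp add: bij_betw_def)
    have "g ` E1 = Inl ` (edges A1 - {g1 None})"
    proof -
      have "g1 ` Some ` E1 = edges A1 - {g1 None}"
        unfolding img(1)[symmetric] using injg(1) by (auto simp: inj_on_def)
      moreover have "g ` E1 = Inl ` g1 ` Some ` E1"
        unfolding image_image by (intro image_cong) (auto simp: g_def)
      ultimately show ?thesis by simp
    qed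
    moreover have "g ` E2 = Inr ` (edges A2 - {g2 None})"
    proof -
      have "g2 ` Some ` E2 = edges A2 - {g2 None}"
        unfolding img(2)[symmetric] using injg(2) by (auto simp: inj_on_def)
      moreover have "g ` E2 = Inr ` g2 ` Some ` E2"
        unfolding image_image using edges_Int by (intro image_cong) (auto simp: g_def)
      ultimately show ?thesis by simp
    qed
    moreover have "edges H = Inl ` (edges A1 - {g1 None}) \<union> Inr ` (edges A2 - {g2 None})"
      unfolding H_def delete_edges_def identify_verts_def disjoint_union_def by auto
    ultimately have "g ` edges G = edges H" unfolding edges_eq by (simp add: image_Un)
    moreover have "inj_on g (edges G)"
      unfolding edges_eq using injg by (auto simp: inj_on_def g_def)
    ultimately show "bij_betw g (edges G) (edges H)" by (simp add: bij_betw_def)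
    fix e assume e: "e \<in> edges G"
    show "ends H (g e) = f ` ends G e"
    proof (cases "e \<in> E1")
      case True
      then have "ends H (g e) = q ` Inl ` f1 ` ends G e"
        using ends1[of "Some e"] by (simp add: g_def H_def delete_edges_def identify_verts_def disjoint_union_def)
      also have "\<dots> = f ` ends G e"
        unfolding image_image using ends_E1[OF True] fV1 by (intro image_cong) auto
      finally show ?thesis .
    next
      case False
      then have E2: "e \<in> E2" using e edges_eq by auto
      then have "ends H (g e) = q ` Inr ` f2 ` ends G e"
        using False ends2[of "Some e"] by (simp add: g_def H_def delete_edges_def identify_verts_def disjoint_union_def)
      also have "\<dots> = f ` ends G e"
        unfolding image_image using ends_E2[OF E2] fV2 by (intro image_cong) auto
      finally show ?thesis .
    qed
  qed
  with \<open>construction_A 2 A1 A2 H\<close> show ?thesis by (rule that)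
qed

section \<open>Tight graphs and the class generated by K4\<close>

lemma K4_class_tight: "K4_class \<delta> G \<Longrightarrow> tight G"
proof (induction rule: K4_class.induct)
  case (K4 G)
  then show ?case using tight_iso tight_K4 by blast
next
  case (construction_A G1 G2 H G)
  have "multigraph H" using construction_A.hyps by (simp add: mgraph_iso_def)
  then obtain V1 V2 E1 E2 u v where sep: "separation H V1 V2 E1 E2 u v"
    and iso: "mgraph_iso (torso H V1 E1 u v) G1" "mgraph_iso (torso H V2 E2 u v) G2"
    by (rule construction_A_separation[OF construction_A.hyps(3)])
  have "tight H"
    using separation.tight_of_torsos[OF sep] tight_iso[OF iso(1)] tight_iso[OF iso(2)] construction_A.IH by blast
  then show ?case using tight_iso construction_A.hyps by blast
qed

text \<open>Induction on the number of vertices: without a cut pair the graph is K4; otherwise both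
  torsos are 2-connected, tight and smaller, and their copies on natural numbers are recombined by
  Construction A.\<close>

lemma tight_K4_class:
  fixes G :: "(nat, nat) mgraph"
  assumes "two_connected G" "tight G" "3 \<le> card (verts G)"
  shows "K4_class 2 G"
  using assms
proof (induction "card (verts G)" arbitrary: G rule: less_induct)
  case less
  have mg: "multigraph G" and V: "tconn G (verts G)"
    using less.prems(1) by (simp_all add: two_connected_iff_tconn)
  show ?case
  proof (cases "\<forall>v\<in>verts G. tconn G (verts G - {v})")
    case True
    then show ?thesis using mgraph_iso_K4[OF mg less.prems(2,3)] K4_class.K4 by blast
  next
    case False
    then obtain v where v: "v \<in> verts G" "\<not> tconn G (verts G - {v})" by blast
    obtain V1 V2 E1 E2 u where sep: "separation G V1 V2 E1 E2 u v" and c3: "3 \<le> card V1" "3 \<le> card V2"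
      using separation_of_cut[OF mg V less.prems(3) v] by blast
    have torso_class: "\<exists>A. K4_class 2 A \<and> two_connected A \<and> mgraph_iso (torso G W F u v) A"
      if "separation G W W' F F' u v" and c: "3 \<le> card W" "3 \<le> card W'" for W W' F F'
    proof -
      interpret separation G W W' F F' u v by fact
      have tc: "two_connected G1"
        using multigraph_torso tconn_torso_whole[OF V] by (simp add: two_connected_iff_tconn)
      obtain A :: "(nat, nat) mgraph" where A: "mgraph_iso G1 A"
        using mgraph_iso_nat[OF multigraph_torso] by blast
      have "card (verts A) = card W" using card_verts_iso[OF A] by simp
      moreover have "two_connected A" using two_connected_iso[OF A tc] .
      moreover have "tight A"
        using tight_iso[OF mgraph_iso_sym[OF A]] tight_torso[OF V less.prems(2) c] by blast
      \<comment> \<open>The other side has at least three vertices and only two are shared, so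
        \<open>card W < card (verts G)\<close>.\<close>
      ultimately show ?thesis using less.hyps[of A] card_verts_Un c A by auto
    qed
    obtain A1 where A1: "K4_class 2 A1" "two_connected A1" "mgraph_iso (torso G V1 E1 u v) A1"
      using torso_class[OF sep c3] by blast
    obtain A2 where A2: "K4_class 2 A2" "two_connected A2" "mgraph_iso (torso G V2 E2 u v) A2"
      using torso_class[OF separation.separation_swap[OF sep] c3(2,1)] by blast
    obtain H where "construction_A 2 A1 A2 H" "mgraph_iso G H"
      using separation.construction_A_of_torsos[OF sep A1(2) A2(2) A1(3) A2(3)] by blast
    then show ?thesis using K4_class.construction_A A1 A2 by blast
  qed
qed

theorem theorem2p25:
  fixes G :: "('v, 'e) mgraph"
  assumes "two_connected G"
  shows "spade 2 G \<longleftrightarrow> mgraph_iso G C2 \<or> (\<exists>H. K4_class 2 H \<and> mgraph_iso G H)"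
  unfolding spade_2_iff_tight[OF assms]
proof
  assume t: "tight G"
  have mg: "multigraph G" and c: "2 \<le> card (verts G)" using assms by (auto simp: two_connected_def)
  show "mgraph_iso G C2 \<or> (\<exists>H. K4_class 2 H \<and> mgraph_iso G H)"
  proof (cases "card (verts G) = 2")
    case True
    then show ?thesis using mgraph_iso_C2[OF mg _ t] by blast
  next
    case False
    obtain H :: "(nat, nat) mgraph" where H: "mgraph_iso G H" using mgraph_iso_nat[OF mg] by blast
    have "K4_class 2 H"
      using two_connected_iso[OF H assms] tight_iso[OF mgraph_iso_sym[OF H] t] card_verts_iso[OF H] c False
      by (intro tight_K4_class) auto
    then show ?thesis using H by blast
  qed
next
  assume "mgraph_iso G C2 \<or> (\<exists>H. K4_class 2 H \<and> mgraph_iso G H)"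
  then show "tight G" using tight_iso tight_C2 K4_class_tight by blast
qed

end
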